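(* Let $k\ge1$, let $\Delta=\prod_{1\le i<j\le k}(z_i-z_j)^2$ regarded as a polynomial in $\mathbb{C}[\sigma_1,\dots,\sigma_k]$, where $\sigma_1,\dots,\sigma_k$ are the elementary symmetric functions of $z_1,\dots,z_k$, and let $b$ be the Bernstein polynomial of $\Delta\in\mathbb{C}[\sigma_1,\dots,\sigma_k]$. Then $b(-1/2)\neq0$.
   Context: The Bernstein polynomial of $\Delta$ is the monic polynomial $b(s)\in\mathbb{C}[s]$ of minimal degree for which there exists $Q(s)\in W_2[s]$ with $Q(s)\,\Delta^{s+1}=b(s)\,\Delta^s$, where $W_2=\mathbb{C}\langle\sigma_1,\dots,\sigma_k,\partial/\partial\sigma_1,\dots,\partial/\partial\sigma_k\rangle$ is the Weyl algebra in $\sigma_1,\dots,\sigma_k$ and the identity is in $\mathbb{C}[\sigma][s,\Delta^{-1}]\Delta^s$. *)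

theory Defs
  imports "HOL-Library.Poly_Mapping" "HOL-Computational_Algebra.Computational_Algebra"
begin

section \<open>Polynomials in several variables\<close>

type_synonym cmpoly = "(nat \<Rightarrow>\<^sub>0 nat) \<Rightarrow>\<^sub>0 complex"

definition indet :: "nat \<Rightarrow> cmpoly" where
  "indet i = Poly_Mapping.single (Poly_Mapping.single i 1) 1"

definition const_poly :: "complex \<Rightarrow> cmpoly" where
  "const_poly c = Poly_Mapping.single 0 c"

definition variables :: "cmpoly \<Rightarrow> nat set" where
  "variables p = (\<Union>m\<in>Poly_Mapping.keys p. Poly_Mapping.keys m)"

definition substitute :: "(nat \<Rightarrow> cmpoly) \<Rightarrow> cmpoly \<Rightarrow> cmpoly" where
  "substitute g p =
     (\<Sum>m\<in>Poly_Mapping.keys p. const_poly (Poly_Mapping.lookup p m) *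
        (\<Prod>i\<in>Poly_Mapping.keys m. g i ^ Poly_Mapping.lookup m i))"

text \<open>In \<open>partial_deriv\<close> the truncated subtraction of exponents is harmless: a monomial
  not containing the \<open>i\<close>-th variable gets the coefficient 0.\<close>

definition partial_deriv :: "nat \<Rightarrow> cmpoly \<Rightarrow> cmpoly" where
  "partial_deriv i p =
     (\<Sum>m\<in>Poly_Mapping.keys p. Poly_Mapping.single (m - Poly_Mapping.single i 1)
        (of_nat (Poly_Mapping.lookup m i) * Poly_Mapping.lookup p m))"

lemma partial_deriv_superset:
  assumes "finite A" "Poly_Mapping.keys p \<subseteq> A"
  shows "partial_deriv i p =
     (\<Sum>m\<in>A. Poly_Mapping.single (m - Poly_Mapping.single i 1)
        (of_nat (Poly_Mapping.lookup m i) * Poly_Mapping.lookup p m))"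
  unfolding partial_deriv_def using assms
  by (intro sum.mono_neutral_left) (auto simp: in_keys_iff)

lemma partial_deriv_single:
  "partial_deriv i (Poly_Mapping.single m c) =
     Poly_Mapping.single (m - Poly_Mapping.single i 1) (of_nat (Poly_Mapping.lookup m i) * c)"
  by (subst partial_deriv_superset[of "{m}"]) auto

lemma partial_deriv_zero [simp]: "partial_deriv i 0 = 0"
  by (simp add: partial_deriv_def)

lemma partial_deriv_add: "partial_deriv i (p + q) = partial_deriv i p + partial_deriv i q"
proof -
  let ?A = "Poly_Mapping.keys p \<union> Poly_Mapping.keys q"
  have "Poly_Mapping.keys (p + q) \<subseteq> ?A"
    by (rule Poly_Mapping.keys_add)
  then show ?thesis
    by (simp add: partial_deriv_superset[of ?A] lookup_add ring_distribs
        flip: sum.distrib single_add)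
qed

lemma partial_deriv_sum: "partial_deriv i (sum f A) = (\<Sum>a\<in>A. partial_deriv i (f a))"
  by (induction A rule: infinite_finite_induct) (auto simp: partial_deriv_add)

lemma cmpoly_as_sum:
  fixes p :: cmpoly
  shows "p = (\<Sum>m\<in>Poly_Mapping.keys p. Poly_Mapping.single m (Poly_Mapping.lookup p m))"
  by (rule poly_mapping_eqI)
    (auto simp: lookup_sum lookup_single when_def in_keys_iff)

lemma partial_deriv_mult_single:
  fixes a b :: complex and m n :: "nat \<Rightarrow>\<^sub>0 nat"
  defines "p \<equiv> Poly_Mapping.single m a" and "q \<equiv> Poly_Mapping.single n b"
  shows "partial_deriv i (p * q) = partial_deriv i p * q + p * partial_deriv i q"
proof -
  let ?e = "Poly_Mapping.single i (Suc 0)"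
  have m: "m + n - ?e = n + (m - ?e)" if "0 < Poly_Mapping.lookup m i"
    using that
    by (intro poly_mapping_eqI) (auto simp: lookup_add lookup_minus lookup_single when_def)
  have n: "m + n - ?e = m + (n - ?e)" if "0 < Poly_Mapping.lookup n i"
    using that
    by (intro poly_mapping_eqI) (auto simp: lookup_add lookup_minus lookup_single when_def)
  have mn: "m + (n - ?e) = n + (m - ?e)"
    if "0 < Poly_Mapping.lookup m i" "0 < Poly_Mapping.lookup n i"
    using m n that by simp
  show ?thesis
    unfolding p_def q_def
    by (cases "Poly_Mapping.lookup m i = 0"; cases "Poly_Mapping.lookup n i = 0")
      (simp_all add: partial_deriv_single mult_single lookup_add m n mn algebra_simps
        flip: single_add)
qed

lemma partial_deriv_mult:
  "partial_deriv i (p * q) = partial_deriv i p * q + p * partial_deriv i q"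
proof -
  let ?s = "\<lambda>p m. Poly_Mapping.single m (Poly_Mapping.lookup p m) :: cmpoly"
  have "partial_deriv i ((\<Sum>m\<in>A. ?s p m) * (\<Sum>n\<in>B. ?s q n)) =
      partial_deriv i (\<Sum>m\<in>A. ?s p m) * (\<Sum>n\<in>B. ?s q n) +
      (\<Sum>m\<in>A. ?s p m) * partial_deriv i (\<Sum>n\<in>B. ?s q n)" for A B
    unfolding sum_product partial_deriv_sum
    by (simp add: partial_deriv_mult_single sum.distrib)
  from this[of "Poly_Mapping.keys p" "Poly_Mapping.keys q"] show ?thesis
    by (simp flip: cmpoly_as_sum)
qed

definition fract_deriv :: "nat \<Rightarrow> cmpoly fract \<Rightarrow> cmpoly fract" where
  "fract_deriv i q =
     (case SOME (a, b). b \<noteq> 0 \<and> q = Fract a b of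
        (a, b) \<Rightarrow> Fract (partial_deriv i a * b - a * partial_deriv i b) (b * b))"

lemma fract_deriv_Fract:
  assumes "b \<noteq> 0"
  shows "fract_deriv i (Fract a b) =
    Fract (partial_deriv i a * b - a * partial_deriv i b) (b * b)"
proof -
  define P where "P = (\<lambda>(c, d). d \<noteq> 0 \<and> Fract a b = Fract c d)"
  obtain c d where cd: "(SOME x. P x) = (c, d)"
    by fastforce
  have "P (a, b)"
    using assms by (simp add: P_def)
  then have "P (SOME x. P x)"
    by (rule someI)
  then have nz: "d \<noteq> 0" and "Fract a b = Fract c d"
    by (simp_all add: cd) (simp_all add: P_def)
  then have eq: "a * d = c * b"
    using assms by (simp add: eq_fract)
  have deq: "partial_deriv i a * d + a * partial_deriv i d =
      partial_deriv i c * b + c * partial_deriv i b"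
    using arg_cong[OF eq, of "partial_deriv i"] by (simp add: partial_deriv_mult)
  have "(partial_deriv i c * d - c * partial_deriv i d) * (b * b) =
      (partial_deriv i a * b - a * partial_deriv i b) * (d * d)"
    using eq deq by algebra
  then have "Fract (partial_deriv i c * d - c * partial_deriv i d) (d * d) =
      Fract (partial_deriv i a * b - a * partial_deriv i b) (b * b)"
    using assms nz by (simp add: eq_fract)
  then show ?thesis
    using cd by (simp add: fract_deriv_def P_def)
qed


section \<open>The discriminant in the elementary symmetric functions\<close>

text \<open>In \<open>elem_sym k j\<close> the variables \<open>indet 1, \<dots>, indet k\<close> play the role of
  $z_1, \dots, z_k$; in \<open>D\<close> below they play the role of $\sigma_1, \dots, \sigma_k$.
  As the elementary symmetric functions are algebraically independent and the squared
  Vandermonde product is symmetric, exactly one \<open>D\<close> satisfies \<open>is_discriminant k D\<close>.\<close>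

definition elem_sym :: "nat \<Rightarrow> nat \<Rightarrow> cmpoly" where
  "elem_sym k j = (\<Sum>S | S \<subseteq> {1..k} \<and> card S = j. \<Prod>i\<in>S. indet i)"

definition is_discriminant :: "nat \<Rightarrow> cmpoly \<Rightarrow> bool" where
  "is_discriminant k D \<longleftrightarrow>
     variables D \<subseteq> {1..k} \<and>
     substitute (elem_sym k) D =
       (\<Prod>(i, j) \<in> {(i, j). 1 \<le> i \<and> i < j \<and> j \<le> k}. (indet i - indet j)\<^sup>2)"


section \<open>The Weyl algebra acting on powers of a polynomial, and the Bernstein polynomial\<close>

text \<open>
  For a polynomial \<open>f \<noteq> 0\<close> in \<open>indet 1, \<dots>, indet k\<close>, the module
  $\mathbb{C}[\sigma][s,f^{-1}]\,f^s$ is free of rank one over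
  $\mathbb{C}[\sigma][s,f^{-1}] \subseteq \mathbb{C}(\sigma)[s]$ on the symbol $f^s$.
  Its element $g f^s$ is represented by the coefficient \<open>g\<close>, a polynomial in $s$ over
  the fraction field. The equation defining the Bernstein polynomial lies in this submodule,
  which is stable under all operators below, so it may be tested in $\mathbb{C}(\sigma)[s]$.

  The Leibniz rule $\partial_i (g f^s) = (\partial_i g + s\,g\,\partial_i f / f)\, f^s$
  gives the action of $\partial/\partial\sigma_i$.
\<close>

definition deriv_fs :: "cmpoly \<Rightarrow> nat \<Rightarrow> cmpoly fract poly \<Rightarrow> cmpoly fract poly" where
  "deriv_fs f i g =
     map_poly (fract_deriv i) g + [:0, to_fract (partial_deriv i f) / to_fract f:] * g"

text \<open>
  \<open>weyl_algebra_s k f\<close> is the algebra $W[s]$, with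
  $W = \mathbb{C}\langle\sigma_1,\dots,\sigma_k,\partial_1,\dots,\partial_k\rangle$, as an algebra
  of operators on this module: it is generated by the actions of the scalars, of $s$, of the
  $\sigma_i$ and of the $\partial_i$. The Weyl relations hold for these operators, and the
  action of $W[s]$ is faithful.
\<close>

inductive_set weyl_algebra_s ::
    "nat \<Rightarrow> cmpoly \<Rightarrow> (cmpoly fract poly \<Rightarrow> cmpoly fract poly) set"
  for k :: nat and f :: cmpoly where
  scalar: "(\<lambda>g. smult (to_fract (const_poly c)) g) \<in> weyl_algebra_s k f"
| s: "(\<lambda>g. [:0, 1:] * g) \<in> weyl_algebra_s k f"
| sigma: "i \<in> {1..k} \<Longrightarrow> (\<lambda>g. smult (to_fract (indet i)) g) \<in> weyl_algebra_s k f"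
| partial: "i \<in> {1..k} \<Longrightarrow> deriv_fs f i \<in> weyl_algebra_s k f"
| add: "P \<in> weyl_algebra_s k f \<Longrightarrow> Q \<in> weyl_algebra_s k f \<Longrightarrow>
    (\<lambda>g. P g + Q g) \<in> weyl_algebra_s k f"
| mult: "P \<in> weyl_algebra_s k f \<Longrightarrow> Q \<in> weyl_algebra_s k f \<Longrightarrow>
    P \<circ> Q \<in> weyl_algebra_s k f"

text \<open>The equation $Q(s)\, f^{s+1} = b(s)\, f^s$, where $f^{s+1} = f \cdot f^s$.\<close>

definition bernstein_equation :: "nat \<Rightarrow> cmpoly \<Rightarrow> complex poly \<Rightarrow> bool" where
  "bernstein_equation k f b \<longleftrightarrow>
     (\<exists>Q \<in> weyl_algebra_s k f. Q [:to_fract f:] = map_poly (\<lambda>c. to_fract (const_poly c)) b)"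

definition is_bernstein_polynomial :: "nat \<Rightarrow> cmpoly \<Rightarrow> complex poly \<Rightarrow> bool" where
  "is_bernstein_polynomial k f b \<longleftrightarrow>
     lead_coeff b = 1 \<and> bernstein_equation k f b \<and>
     (\<forall>c. lead_coeff c = 1 \<and> bernstein_equation k f c \<longrightarrow>
        Polynomial.degree b \<le> Polynomial.degree c)"

end

theory Submission
  imports Defs
begin

text \<open>
  Restricted to functions of the elementary symmetric polynomials, the Dunkl--Laplace operator
  \<open>L(\<kappa>) = \<Sum>\<^sub>i \<partial>\<^sub>i\<^sup>2 + 2\<kappa> \<Sum>\<^bsub>i<j\<^esub> (\<partial>\<^sub>i - \<partial>\<^sub>j) / (z\<^sub>i - z\<^sub>j)\<close> is a differential operator with polynomial
  coefficients in the \<open>\<sigma>\<^sub>a\<close> and \<open>\<kappa>\<close>. Conjugation by \<open>\<Delta>\<^sup>s\<close> turns \<open>L(1/2 - s)\<close> into \<open>L(1/2 + s)\<close>;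
  this amounts to two polynomial identities for the derivatives of \<open>\<Delta>\<close>, which are checked in the
  coordinates \<open>z\<close>. With \<open>N = k(k - 1)/2\<close> it gives \<open>L(1/2 - s)\<^sup>N \<Delta>\<^bsup>s+1\<^esup> = (L(1/2 + s)\<^sup>N \<Delta>) \<Delta>\<^sup>s\<close>,
  where the coefficient on the right is homogeneous of degree 0, hence a polynomial \<open>c(s)\<close>, and is
  divisible by \<open>b(s)\<close>. At \<open>s = -1/2\<close> it is the \<open>N\<close>-th power of the Laplacian applied to the square
  of the Vandermonde product. The latter is a real harmonic polynomial, so the result is a
  positive multiple of the sum of the squares of its derivatives of order \<open>N\<close>.
\<close>

section \<open>Polynomials and substitution\<close>

lemma const_poly_0 [simp]: "const_poly 0 = 0"
  by (simp add: const_poly_def)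

lemma const_poly_1 [simp]: "const_poly 1 = 1"
  by (simp add: const_poly_def)

lemma const_poly_add: "const_poly (a + b) = const_poly a + const_poly b"
  by (simp add: const_poly_def single_add)

lemma const_poly_mult: "const_poly (a * b) = const_poly a * const_poly b"
  by (simp add: const_poly_def mult_single)

lemma const_poly_uminus: "const_poly (- a) = - const_poly a"
  by (simp add: const_poly_def single_uminus)

lemma const_poly_of_nat: "const_poly (of_nat n) = of_nat n"
  by (induction n) (simp_all add: const_poly_add)

lemma const_poly_eq_iff [simp]: "const_poly a = const_poly b \<longleftrightarrow> a = b"
  by (metis const_poly_def lookup_single_eq)

lemma const_poly_eq_0_iff [simp]: "const_poly a = 0 \<longleftrightarrow> a = 0"
  using const_poly_eq_iff[of a 0] by (simp del: const_poly_eq_iff)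

lemma lookup_const_poly_mult:
  "Poly_Mapping.lookup (const_poly c * p) m = c * Poly_Mapping.lookup p m"
  unfolding const_poly_def mult_map_scale_conv_mult[symmetric]
  by (simp add: Poly_Mapping.map.rep_eq when_def)

lemma lookup_partial_deriv:
  "Poly_Mapping.lookup (partial_deriv i p) m =
     of_nat (Suc (Poly_Mapping.lookup m i)) *
       Poly_Mapping.lookup p (m + Poly_Mapping.single i 1)"
proof -
  let ?e = "Poly_Mapping.single i 1 :: nat \<Rightarrow>\<^sub>0 nat"
  \<comment> \<open>Exponent subtraction is truncated, so the shift is invertible only on monomials
    that contain the variable; the others enter the sum with coefficient 0.\<close>
  have eq: "n - ?e = m \<longleftrightarrow> n = m + ?e" if "Poly_Mapping.lookup n i > 0" for n
    using that
    by (auto simp: poly_mapping_eq_iff fun_eq_iff lookup_add lookup_minus lookup_single when_def)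
  have "Poly_Mapping.lookup (partial_deriv i p) m =
      (\<Sum>n\<in>Poly_Mapping.keys p. if n = m + ?e then
         of_nat (Poly_Mapping.lookup n i) * Poly_Mapping.lookup p n else 0)"
    unfolding partial_deriv_def lookup_sum
    by (intro sum.cong refl) (use eq in \<open>auto simp: lookup_single when_def\<close>)
  also have "\<dots> = of_nat (Suc (Poly_Mapping.lookup m i)) * Poly_Mapping.lookup p (m + ?e)"
    by (auto simp: lookup_add in_keys_iff)
  finally show ?thesis .
qed

lemma partial_deriv_const_poly [simp]: "partial_deriv i (const_poly c) = 0"
  by (simp add: const_poly_def partial_deriv_single)

lemma partial_deriv_1 [simp]: "partial_deriv i 1 = 0"
  using partial_deriv_const_poly[of i 1] by (simp del: partial_deriv_const_poly)

lemma partial_deriv_indet: "partial_deriv i (indet j) = (if i = j then 1 else 0)"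
  by (auto simp: indet_def partial_deriv_single lookup_single)

lemma variables_const_poly [simp]: "variables (const_poly c) = {}"
  by (auto simp: variables_def const_poly_def)

lemma variables_0 [simp]: "variables 0 = {}"
  by (simp add: variables_def)

lemma variables_1 [simp]: "variables 1 = {}"
  by (auto simp: variables_def)

lemma variables_indet [simp]: "variables (indet i) = {i}"
  by (auto simp: variables_def indet_def)

lemma variables_uminus [simp]: "variables (- p) = variables p"
  by (simp add: variables_def)

lemma variables_add: "variables (p + q) \<subseteq> variables p \<union> variables q"
  using Poly_Mapping.keys_add[of p q] by (auto simp: variables_def)

lemma variables_mult: "variables (p * q) \<subseteq> variables p \<union> variables q"
proof -
  have "\<exists>a b. m = a + b \<and> a \<in> Poly_Mapping.keys p \<and> b \<in> Poly_Mapping.keys q"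
    if "m \<in> Poly_Mapping.keys (p * q)" for m
    using keys_mult[of p q] that by blast
  then show ?thesis
    using Poly_Mapping.keys_add unfolding variables_def by fastforce
qed

lemma variables_partial_deriv: "variables (partial_deriv i p) \<subseteq> variables p"
proof -
  have "m + Poly_Mapping.single i 1 \<in> Poly_Mapping.keys p"
    if "m \<in> Poly_Mapping.keys (partial_deriv i p)" for m
    using that by (auto simp: in_keys_iff lookup_partial_deriv)
  moreover have "Poly_Mapping.keys m \<subseteq> Poly_Mapping.keys (m + Poly_Mapping.single i (1::nat))"
    for m :: "nat \<Rightarrow>\<^sub>0 nat"
    by (auto simp: in_keys_iff lookup_add)
  ultimately show ?thesis
    unfolding variables_def by blast
qed

lemma indet_power: "indet i ^ n = Poly_Mapping.single (Poly_Mapping.single i n) 1"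
  by (induction n) (simp_all add: indet_def mult_single flip: single_add)

lemma monomial_as_prod:
  fixes m :: "nat \<Rightarrow>\<^sub>0 nat"
  shows "(Poly_Mapping.single m 1 :: cmpoly) =
     (\<Prod>i\<in>Poly_Mapping.keys m. indet i ^ Poly_Mapping.lookup m i)"
proof -
  have "(\<Prod>i\<in>A. indet i ^ Poly_Mapping.lookup m i) =
      (Poly_Mapping.single (\<Sum>i\<in>A. Poly_Mapping.single i (Poly_Mapping.lookup m i)) 1 :: cmpoly)"
    for A
    by (induction A rule: infinite_finite_induct) (simp_all add: indet_power mult_single)
  moreover have "(\<Sum>i\<in>Poly_Mapping.keys m. Poly_Mapping.single i (Poly_Mapping.lookup m i)) = m"
    by (rule poly_mapping_eqI) (auto simp: lookup_sum lookup_single when_def in_keys_iff)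
  ultimately show ?thesis
    by metis
qed

lemma cmpoly_induct [consumes 1, case_names const indet add mult]:
  assumes vars: "variables p \<subseteq> A"
    and const: "\<And>c. P (const_poly c)"
    and indet: "\<And>i. i \<in> A \<Longrightarrow> P (indet i)"
    and add: "\<And>p q. variables p \<subseteq> A \<Longrightarrow> variables q \<subseteq> A \<Longrightarrow> P p \<Longrightarrow> P q \<Longrightarrow> P (p + q)"
    and mult: "\<And>p q. variables p \<subseteq> A \<Longrightarrow> variables q \<subseteq> A \<Longrightarrow> P p \<Longrightarrow> P q \<Longrightarrow> P (p * q)"
  shows "P p"
proof -
  define R where "R = (\<lambda>q. variables q \<subseteq> A \<and> P q)"
  have Rc: "R (const_poly c)" for c
    by (simp add: R_def const)
  have Ri: "R (indet i)" if "i \<in> A" for i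
    using that by (simp add: R_def indet)
  have Ra: "R (x + y)" if "R x" "R y" for x y
    using that add[of x y] variables_add[of x y] by (auto simp: R_def)
  have Rm: "R (x * y)" if "R x" "R y" for x y
    using that mult[of x y] variables_mult[of x y] by (auto simp: R_def)
  have Rp: "R (x ^ n)" if "R x" for x n
    using that by (induction n) (auto intro: Rm simp: Rc[of 1, simplified])
  have Rprod: "R (prod g B)" if "\<And>x. x \<in> B \<Longrightarrow> R (g x)" for g and B :: "nat set"
    using that by (induction B rule: infinite_finite_induct) (auto intro: Rm simp: Rc[of 1, simplified])
  have Rsum: "R (sum g B)" if "\<And>x. x \<in> B \<Longrightarrow> R (g x)" for g and B :: "(nat \<Rightarrow>\<^sub>0 nat) set"
    using that by (induction B rule: infinite_finite_induct) (auto intro: Ra simp: Rc[of 0, simplified])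
  have "R (const_poly (Poly_Mapping.lookup p m) *
      (\<Prod>i\<in>Poly_Mapping.keys m. indet i ^ Poly_Mapping.lookup m i))"
    if "m \<in> Poly_Mapping.keys p" for m
    using that vars by (intro Rm Rc Rprod Rp Ri) (auto simp: variables_def)
  then have "R (\<Sum>m\<in>Poly_Mapping.keys p. Poly_Mapping.single m (Poly_Mapping.lookup p m))"
    by (intro Rsum) (simp add: const_poly_def mult_single flip: monomial_as_prod)
  then show ?thesis
    by (simp add: R_def flip: cmpoly_as_sum)
qed

lemma partial_deriv_commute:
  "partial_deriv i (partial_deriv j p) = partial_deriv j (partial_deriv i p)"
proof -
  have "variables p \<subseteq> UNIV" by simp
  then show ?thesis
    by (induction p rule: cmpoly_induct)
      (simp_all add: partial_deriv_indet partial_deriv_add partial_deriv_mult algebra_simps)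
qed

lemma partial_deriv_uminus: "partial_deriv i (- p) = - partial_deriv i p"
  using partial_deriv_add[of i p "- p"] by (simp add: eq_neg_iff_add_eq_0 add.commute)

lemma partial_deriv_diff: "partial_deriv i (p - q) = partial_deriv i p - partial_deriv i q"
  using partial_deriv_add[of i p "- q"] by (simp add: partial_deriv_uminus)

lemma partial_deriv_of_nat [simp]: "partial_deriv i (of_nat n) = 0"
  by (simp flip: const_poly_of_nat)

section \<open>Substitution as a ring homomorphism, and the chain rule\<close>

lemma substitute_superset:
  assumes "finite A" "Poly_Mapping.keys p \<subseteq> A"
  shows "substitute g p = (\<Sum>m\<in>A. const_poly (Poly_Mapping.lookup p m) *
        (\<Prod>i\<in>Poly_Mapping.keys m. g i ^ Poly_Mapping.lookup m i))"
  unfolding substitute_def using assms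
  by (intro sum.mono_neutral_left) (auto simp: in_keys_iff)

lemma substitute_single:
  "substitute g (Poly_Mapping.single m c) =
     const_poly c * (\<Prod>i\<in>Poly_Mapping.keys m. g i ^ Poly_Mapping.lookup m i)"
  by (subst substitute_superset[of "{m}"]) auto

lemma substitute_add: "substitute g (p + q) = substitute g p + substitute g q"
proof -
  let ?A = "Poly_Mapping.keys p \<union> Poly_Mapping.keys q"
  have "Poly_Mapping.keys (p + q) \<subseteq> ?A"
    by (rule Poly_Mapping.keys_add)
  then show ?thesis
    by (simp add: substitute_superset[of ?A] lookup_add const_poly_add ring_distribs
        flip: sum.distrib)
qed

lemma substitute_0 [simp]: "substitute g 0 = 0"
  by (simp add: substitute_def)

lemma substitute_sum: "substitute g (sum h A) = (\<Sum>a\<in>A. substitute g (h a))"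
  by (induction A rule: infinite_finite_induct) (auto simp: substitute_add)

lemma substitute_mult_single:
  "substitute g (Poly_Mapping.single m a * Poly_Mapping.single n b) =
     substitute g (Poly_Mapping.single m a) * substitute g (Poly_Mapping.single n b)"
proof -
  let ?K = "Poly_Mapping.keys m \<union> Poly_Mapping.keys n"
  have "(\<Prod>i\<in>Poly_Mapping.keys l. g i ^ Poly_Mapping.lookup l i) =
      (\<Prod>i\<in>?K. g i ^ Poly_Mapping.lookup l i)" if "Poly_Mapping.keys l \<subseteq> ?K"
    for l :: "nat \<Rightarrow>\<^sub>0 nat"
    using that by (intro prod.mono_neutral_left) (auto simp: in_keys_iff)
  note P = this
  have "(\<Prod>i\<in>Poly_Mapping.keys (m + n). g i ^ Poly_Mapping.lookup (m + n) i) =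
      (\<Prod>i\<in>Poly_Mapping.keys m. g i ^ Poly_Mapping.lookup m i) *
      (\<Prod>i\<in>Poly_Mapping.keys n. g i ^ Poly_Mapping.lookup n i)"
    unfolding P[OF Poly_Mapping.keys_add] P[OF Un_upper1] P[OF Un_upper2]
    by (simp add: lookup_add power_add prod.distrib)
  then show ?thesis
    by (simp add: mult_single substitute_single const_poly_mult)
qed

lemma substitute_mult: "substitute g (p * q) = substitute g p * substitute g q"
proof -
  let ?s = "\<lambda>p m. Poly_Mapping.single m (Poly_Mapping.lookup p m) :: cmpoly"
  have "substitute g ((\<Sum>m\<in>A. ?s p m) * (\<Sum>n\<in>B. ?s q n)) =
      substitute g (\<Sum>m\<in>A. ?s p m) * substitute g (\<Sum>n\<in>B. ?s q n)" for A B
    unfolding sum_product substitute_sum by (simp add: substitute_mult_single)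
  from this[of "Poly_Mapping.keys p" "Poly_Mapping.keys q"] show ?thesis
    by (simp flip: cmpoly_as_sum)
qed

lemma substitute_const_poly [simp]: "substitute g (const_poly c) = const_poly c"
  by (simp add: const_poly_def[of c] substitute_single)

lemma substitute_1 [simp]: "substitute g 1 = 1"
  using substitute_const_poly[of g 1] by (simp del: substitute_const_poly)

lemma substitute_of_nat [simp]: "substitute g (of_nat n) = of_nat n"
  by (simp flip: const_poly_of_nat)

lemma substitute_indet [simp]: "substitute g (indet i) = g i"
  by (simp add: indet_def substitute_single)

lemma substitute_uminus: "substitute g (- p) = - substitute g p"
  using substitute_add[of g p "- p"] by (simp add: eq_neg_iff_add_eq_0 add.commute)

lemma substitute_diff: "substitute g (p - q) = substitute g p - substitute g q"
  using substitute_add[of g p "- q"] by (simp add: substitute_uminus)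

text \<open>The chain rule: both sides are additive in \<open>p\<close> and obey the same product
  rule over \<open>substitute g\<close>, so agreement on constants and indeterminates
  suffices.\<close>

lemma partial_deriv_substitute:
  assumes "finite A" "variables p \<subseteq> A"
  shows "partial_deriv i (substitute g p) =
     (\<Sum>a\<in>A. substitute g (partial_deriv a p) * partial_deriv i (g a))"
  using assms(2)
proof (induction p rule: cmpoly_induct)
  case (indet j)
  then show ?case
    using assms(1) by (simp add: partial_deriv_indet if_distrib[of "substitute g"]
        if_distrib[of "\<lambda>x. x * _"] cong: if_cong)
qed (simp_all add: partial_deriv_add partial_deriv_mult substitute_add substitute_mult
    sum.distrib sum_distrib_left sum_distrib_right algebra_simps)

text \<open>Multiplying the derivative by its variable gives an operator that is diagonal on
  monomials, so vanishing derivatives and Euler equations can be read off coefficient by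
  coefficient.\<close>

lemma lookup_indet_mult_partial_deriv:
  "Poly_Mapping.lookup (indet i * partial_deriv i p) m =
     of_nat (Poly_Mapping.lookup m i) * Poly_Mapping.lookup p m"
proof -
  have e: "Poly_Mapping.single i (Suc 0) + (n - Poly_Mapping.single i (Suc 0)) = n"
    if "Poly_Mapping.lookup n i > 0" for n :: "nat \<Rightarrow>\<^sub>0 nat"
    using that
    by (intro poly_mapping_eqI) (auto simp: lookup_add lookup_minus lookup_single when_def)
  have "indet i * partial_deriv i p = (\<Sum>n\<in>Poly_Mapping.keys p.
      Poly_Mapping.single n (of_nat (Poly_Mapping.lookup n i) * Poly_Mapping.lookup p n))"
    unfolding partial_deriv_def sum_distrib_left
  proof (intro sum.cong refl)
    fix n
    show "indet i * Poly_Mapping.single (n - Poly_Mapping.single i 1)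
          (of_nat (Poly_Mapping.lookup n i) * Poly_Mapping.lookup p n) =
        Poly_Mapping.single n (of_nat (Poly_Mapping.lookup n i) * Poly_Mapping.lookup p n)"
      by (cases "Poly_Mapping.lookup n i = 0") (simp_all add: indet_def mult_single e)
  qed
  then show ?thesis
    by (auto simp: lookup_sum lookup_single when_def in_keys_iff)
qed

section \<open>Elementary symmetric polynomials\<close>

definition esym :: "nat set \<Rightarrow> nat \<Rightarrow> cmpoly" where
  "esym S a = (\<Sum>T | T \<subseteq> S \<and> card T = a. \<Prod>i\<in>T. indet i)"

lemma elem_sym_eq_esym: "elem_sym k = esym {1..k}"
  by (simp add: fun_eq_iff elem_sym_def esym_def)

lemma esym_0 [simp]:
  assumes "finite S"
  shows "esym S 0 = 1"
proof -
  have "{T. T \<subseteq> S \<and> card T = 0} = {{}}"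
    using assms by (auto dest: finite_subset)
  then show ?thesis
    by (simp add: esym_def)
qed

lemma esym_eq_0:
  assumes "finite S" "card S < a"
  shows "esym S a = 0"
proof -
  have "{T. T \<subseteq> S \<and> card T = a} = {}"
    using assms by (auto dest: card_mono)
  then show ?thesis
    by (metis esym_def sum.empty)
qed

lemma esym_insert:
  assumes S: "finite S" "i \<notin> S"
  shows "esym (insert i S) (Suc a) = esym S (Suc a) + indet i * esym S a"
proof -
  let ?A = "{T. T \<subseteq> S \<and> card T = Suc a}" and ?B = "{T. T \<subseteq> S \<and> card T = a}"
  have "{T. T \<subseteq> insert i S \<and> card T = Suc a} \<subseteq> ?A \<union> insert i ` ?B"
  proof
    fix T assume T: "T \<in> {T. T \<subseteq> insert i S \<and> card T = Suc a}"
    then have "finite T"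
      using S by (auto intro: finite_subset)
    then show "T \<in> ?A \<union> insert i ` ?B"
      using T by (cases "i \<in> T") (auto intro!: image_eqI[of T _ "T - {i}"])
  qed
  moreover have "?A \<union> insert i ` ?B \<subseteq> {T. T \<subseteq> insert i S \<and> card T = Suc a}"
  proof safe
    fix T assume "T \<subseteq> S"
    then show "card (insert i T) = Suc (card T)"
      using S by (intro card_insert_disjoint) (auto dest: finite_subset)
  qed auto
  ultimately have eq: "{T. T \<subseteq> insert i S \<and> card T = Suc a} = ?A \<union> insert i ` ?B"
    by blast
  have "inj_on (insert i) ?B"
    using S by (auto simp: inj_on_def)
  moreover have "(\<Prod>j\<in>insert i T. indet j) = indet i * (\<Prod>j\<in>T. indet j)" if "T \<subseteq> S" for T
    using S that by (subst prod.insert) (auto dest: finite_subset)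
  moreover have "?A \<inter> insert i ` ?B = {}"
    using S by auto
  ultimately show ?thesis
    using S unfolding esym_def eq
    by (subst sum.union_disjoint) (auto simp: sum.reindex sum_distrib_left intro!: sum.cong)
qed

lemma esym_remove:
  assumes "finite S" "i \<in> S"
  shows "esym S (Suc a) = esym (S - {i}) (Suc a) + indet i * esym (S - {i}) a"
  using esym_insert[of "S - {i}" i a] assms by (simp add: insert_absorb)

lemma partial_deriv_esym_notin:
  "finite S \<Longrightarrow> i \<notin> S \<Longrightarrow> partial_deriv i (esym S a) = 0"
proof (induction S arbitrary: a rule: finite_induct)
  case empty
  then show ?case by (cases a) (simp_all add: esym_eq_0)
next
  case (insert j S)
  then show ?case
    by (cases a) (auto simp: esym_insert partial_deriv_add partial_deriv_mult partial_deriv_indet)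
qed

lemma partial_deriv_esym:
  assumes "finite S" "i \<in> S"
  shows "partial_deriv i (esym S (Suc a)) = esym (S - {i}) a"
  using assms
  by (simp add: esym_remove[of S i] partial_deriv_add partial_deriv_mult partial_deriv_indet
      partial_deriv_esym_notin)

text \<open>Double counting: an \<open>a\<close>-element subset of \<open>S\<close> avoids exactly
  \<open>card S - a\<close> elements of \<open>S\<close>. The difference is taken in the polynomial
  ring; for \<open>a > card S\<close> both sides vanish.\<close>

lemma sum_esym_remove:
  "finite S \<Longrightarrow> (\<Sum>i\<in>S. esym (S - {i}) a) = (of_nat (card S) - of_nat a) * esym S a"
proof (induction S arbitrary: a rule: finite_induct)
  case empty
  then show ?case by (cases a) (simp_all add: esym_eq_0)
next
  case (insert j S)
  have rem: "insert j S - {i} = insert j (S - {i})" if "i \<in> S" for i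
    using that insert by auto
  have "(\<Sum>i\<in>insert j S. esym (insert j S - {i}) a) =
      esym S a + (\<Sum>i\<in>S. esym (insert j (S - {i})) a)"
    using insert by (simp add: rem)
  also have "\<dots> = (of_nat (card (insert j S)) - of_nat a) * esym (insert j S) a"
  proof (cases a)
    case 0
    then show ?thesis using insert by simp
  next
    case (Suc b)
    have "(\<Sum>i\<in>S. esym (insert j (S - {i})) a) =
        (\<Sum>i\<in>S. esym (S - {i}) a) + indet j * (\<Sum>i\<in>S. esym (S - {i}) b)"
      using insert.hyps by (simp add: Suc esym_insert sum.distrib flip: sum_distrib_left)
    then show ?thesis
      using insert by (simp add: Suc esym_insert algebra_simps)
  qed
  finally show ?case .
qed

text \<open>Euler's identity for a form of degree \<open>a + 1\<close>.\<close>

lemma euler_esym: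
  assumes "finite S"
  shows "(\<Sum>i\<in>S. indet i * esym (S - {i}) a) = of_nat (Suc a) * esym S (Suc a)"
proof -
  have "(\<Sum>i\<in>S. indet i * esym (S - {i}) a) =
      (\<Sum>i\<in>S. esym S (Suc a) - esym (S - {i}) (Suc a))"
    using assms by (intro sum.cong refl) (simp add: esym_remove)
  also have "\<dots> = of_nat (Suc a) * esym S (Suc a)"
    using assms by (simp only: sum_subtractf sum_esym_remove) (simp add: algebra_simps)
  finally show ?thesis .
qed

text \<open>Eliminating \<open>z_i\<close> between the expansions of \<open>e_(a+1)(S)\<close> and
  \<open>e_(b+1)(S)\<close> by \<open>esym_remove\<close> moves one degree from the first factor to
  the second. Repeated until the first index is 0, this expresses the inner products of gradients
  through the elementary symmetric polynomials of \<open>S\<close>.\<close>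

lemma sum_esym_mult_esym_rec:
  assumes S: "finite S"
  shows "(\<Sum>i\<in>S. esym (S - {i}) (Suc a) * esym (S - {i}) b) =
     (\<Sum>i\<in>S. esym (S - {i}) a * esym (S - {i}) (Suc b))
     - ((of_nat (card S) - of_nat a) * esym S a * esym S (Suc b)
        - (of_nat (card S) - of_nat b) * esym S b * esym S (Suc a))"
proof -
  have "(\<Sum>i\<in>S. esym (S - {i}) (Suc a) * esym (S - {i}) b) =
      (\<Sum>i\<in>S. esym (S - {i}) a * esym (S - {i}) (Suc b)
        - (esym (S - {i}) a * esym S (Suc b) - esym (S - {i}) b * esym S (Suc a)))"
  proof (intro sum.cong refl)
    fix i assume "i \<in> S"
    show "esym (S - {i}) (Suc a) * esym (S - {i}) b = esym (S - {i}) a * esym (S - {i}) (Suc b)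
        - (esym (S - {i}) a * esym S (Suc b) - esym (S - {i}) b * esym S (Suc a))"
      unfolding esym_remove[OF S \<open>i \<in> S\<close>] by algebra
  qed
  also have "\<dots> = (\<Sum>i\<in>S. esym (S - {i}) a * esym (S - {i}) (Suc b))
      - ((\<Sum>i\<in>S. esym (S - {i}) a) * esym S (Suc b) - (\<Sum>i\<in>S. esym (S - {i}) b) * esym S (Suc a))"
    by (simp only: sum_subtractf sum_distrib_right)
  finally show ?thesis
    using S by (simp add: sum_esym_remove)
qed

lemma indet_eq_iff [simp]: "indet i = indet j \<longleftrightarrow> i = j"
  by (metis partial_deriv_indet zero_neq_one)

text \<open>Subtracting two of the equations leaves a system of the same shape in one variable less.\<close>

lemma jacobian_esym_nonsingular:
  assumes "finite S" "\<And>i. i \<in> S \<Longrightarrow> (\<Sum>a<card S. v a * esym (S - {i}) a) = 0" "a < card S"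
  shows "v a = 0"
  using assms
proof (induction "card S" arbitrary: S v a)
  case (Suc n)
  then obtain j where j: "j \<in> S"
    by fastforce
  have card: "card (S - {j}) = n"
    using Suc.hyps(2) Suc.prems(1) j by simp
  have shift: "v (Suc a) = 0" if "a < n" for a
  proof (rule Suc.hyps(1)[of "S - {j}" "\<lambda>a. v (Suc a)"])
    fix i assume i: "i \<in> S - {j}"
    have "esym (S - {i}) (Suc b) - esym (S - {j}) (Suc b) =
        (indet j - indet i) * esym (S - {j} - {i}) b" for b
    proof -
      have *: "S - {i} - {j} = S - {j} - {i}"
        by blast
      show ?thesis
        using Suc.prems(1) i j esym_remove[of "S - {i}" j b] esym_remove[of "S - {j}" i b]
        by (simp add: * algebra_simps)
    qed
    then have "(indet j - indet i) * (\<Sum>b<n. v (Suc b) * esym (S - {j} - {i}) b) =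
        (\<Sum>b<n. v (Suc b) * (esym (S - {i}) (Suc b) - esym (S - {j}) (Suc b)))"
      by (simp add: sum_distrib_left mult.left_commute)
    also have "\<dots> = (\<Sum>b<Suc n. v b * esym (S - {i}) b) - (\<Sum>b<Suc n. v b * esym (S - {j}) b)"
      unfolding sum.lessThan_Suc_shift using Suc.prems(1)
      by (simp add: right_diff_distrib sum_subtractf)
    also have "\<dots> = 0"
      using Suc.prems(2)[of i] Suc.prems(2)[of j] i j Suc.hyps(2) by simp
    finally show "(\<Sum>b<card (S - {j}). v (Suc b) * esym (S - {j} - {i}) b) = 0"
      using i card by auto
  qed (use that card Suc.prems in auto)
  have "(\<Sum>b<Suc n. v b * esym (S - {j}) b) = 0"
    using Suc.prems(2)[of j] j Suc.hyps(2) by simp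
  then have "v 0 = 0"
    unfolding sum.lessThan_Suc_shift using Suc.prems(1) shift by simp
  then show ?case
    using shift Suc.prems(3) Suc.hyps(2) by (cases a) auto
qed simp

section \<open>Algebraic independence of the elementary symmetric polynomials\<close>

lemma eq_const_polyI:
  assumes "\<And>m. m \<noteq> 0 \<Longrightarrow> Poly_Mapping.lookup p m = 0"
  shows "p = const_poly (Poly_Mapping.lookup p 0)"
  using assms by (intro poly_mapping_eqI) (auto simp: const_poly_def lookup_single when_def)

lemma sum_partial_deriv_esym:
  assumes i: "i \<in> {1..k}"
  shows "(\<Sum>a\<in>{1..k}. v a * partial_deriv i (esym {1..k} a)) =
    (\<Sum>a<k. v (Suc a) * esym ({1..k} - {i}) a)"
  using i by (simp add: sum.atLeast1_atMost_eq partial_deriv_esym)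

text \<open>Differentiating a relation by each \<open>z_i\<close> gives a homogeneous linear system
  for the substituted derivatives of \<open>p\<close>, and \<open>jacobian_esym_nonsingular\<close>
  makes them vanish. The derivatives of \<open>p\<close> are thus relations of lower degree, hence
  zero by induction, and \<open>p\<close> is constant.\<close>

lemma substitute_elem_sym_eq_0_imp:
  assumes "variables p \<subseteq> {1..k}" "substitute (elem_sym k) p = 0"
  shows "p = 0"
proof -
  \<comment> \<open>The plain total degree, not the grading with \<open>sigma_a\<close> in degree
    \<open>a\<close>; every derivative lowers it by one.\<close>
  define wt :: "(nat \<Rightarrow>\<^sub>0 nat) \<Rightarrow> nat" where "wt m = (\<Sum>i\<in>{1..k}. Poly_Mapping.lookup m i)" for m
  have "p = 0" if "\<And>m. m \<in> Poly_Mapping.keys p \<Longrightarrow> wt m < n" for n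
    using assms that
  proof (induction n arbitrary: p)
    case 0
    have "m \<notin> Poly_Mapping.keys p" for m
      using "0.prems"(3)[of m] by auto
    then show ?case
      by (intro poly_mapping_eqI) (simp add: in_keys_iff)
  next
    case (Suc n)
    have "substitute (elem_sym k) (partial_deriv (Suc a) p) = 0" if "a < k" for a
    proof (rule jacobian_esym_nonsingular[of "{1..k}"
          "\<lambda>a. substitute (elem_sym k) (partial_deriv (Suc a) p)"])
      fix i assume "i \<in> {1..k}"
      then show "(\<Sum>a<card {1..k}. substitute (elem_sym k) (partial_deriv (Suc a) p) *
          esym ({1..k} - {i}) a) = 0"
        using partial_deriv_substitute[of "{1..k}" p i "elem_sym k"] Suc.prems
          sum_partial_deriv_esym[of i k "\<lambda>a. substitute (elem_sym k) (partial_deriv a p)"]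
        by (simp add: elem_sym_eq_esym)
    qed (use that in auto)
    then have eq0: "substitute (elem_sym k) (partial_deriv a p) = 0" if "a \<in> {1..k}" for a
      using that by (cases a) auto
    have deriv0: "partial_deriv a p = 0" if a: "a \<in> {1..k}" for a
    proof (rule Suc.IH)
      fix m assume "m \<in> Poly_Mapping.keys (partial_deriv a p)"
      then have "m + Poly_Mapping.single a 1 \<in> Poly_Mapping.keys p"
        by (auto simp: in_keys_iff lookup_partial_deriv)
      then have "wt (m + Poly_Mapping.single a 1) < Suc n"
        by (rule Suc.prems)
      then show "wt m < n"
        using a by (simp add: wt_def lookup_add sum.distrib lookup_single when_def)
    qed (use eq0[OF a] Suc.prems(1) variables_partial_deriv[of a p] in auto)
    have "Poly_Mapping.lookup p m = 0" if "m \<noteq> 0" for m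
    proof (rule ccontr)
      assume nz: "Poly_Mapping.lookup p m \<noteq> 0"
      obtain i where i: "i \<in> Poly_Mapping.keys m"
        using \<open>m \<noteq> 0\<close> keys_eq_empty[of m] by blast
      moreover have "m \<in> Poly_Mapping.keys p"
        using nz by (simp add: in_keys_iff)
      ultimately have "i \<in> {1..k}"
        using Suc.prems(1) unfolding variables_def by blast
      then show False
        using lookup_indet_mult_partial_deriv[of i p m] deriv0 i nz
        by (simp add: in_keys_iff)
    qed
    then obtain c where "p = const_poly c"
      using eq_const_polyI by blast
    then show ?case
      using Suc.prems(2) by simp
  qed
  moreover have "wt m < Suc (Max (wt ` Poly_Mapping.keys p))" if "m \<in> Poly_Mapping.keys p" for m
    using that by (simp add: less_Suc_eq_le)
  ultimately show ?thesis
    by blast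
qed

text \<open>Identities between polynomials in the \<open>sigma_a\<close> may therefore be checked in
  the coordinates \<open>z\<close>.\<close>

lemma substitute_elem_sym_inject:
  assumes "variables p \<subseteq> {1..k}" "variables q \<subseteq> {1..k}"
    and "substitute (elem_sym k) p = substitute (elem_sym k) q"
  shows "p = q"
proof -
  have "variables (p - q) \<subseteq> {1..k}"
    using variables_add[of p "- q"] assms(1,2) by auto
  then have "p - q = 0"
    by (rule substitute_elem_sym_eq_0_imp) (simp add: substitute_diff assms(3))
  then show ?thesis by simp
qed

section \<open>The Vandermonde product is harmonic\<close>

definition pairs :: "nat \<Rightarrow> (nat \<times> nat) set" where
  "pairs k = {(i, j). 1 \<le> i \<and> i < j \<and> j \<le> k}"

definition vandermonde :: "nat \<Rightarrow> cmpoly" where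
  "vandermonde k = (\<Prod>(i, j)\<in>pairs k. indet i - indet j)"

definition laplacian :: "nat set \<Rightarrow> cmpoly \<Rightarrow> cmpoly" where
  "laplacian S p = (\<Sum>i\<in>S. partial_deriv i (partial_deriv i p))"

text \<open>With all weights 1 this is the Euler operator in \<open>z\<close>; with weight
  \<open>a\<close> on the variable \<open>a\<close> it belongs to the grading in which
  \<open>sigma_a\<close> has degree \<open>a\<close>.\<close>

definition weighted_euler :: "(nat \<Rightarrow> nat) \<Rightarrow> nat set \<Rightarrow> cmpoly \<Rightarrow> cmpoly" where
  "weighted_euler w S p = (\<Sum>i\<in>S. of_nat (w i) * (indet i * partial_deriv i p))"

lemma finite_pairs [simp]: "finite (pairs k)"
proof -
  have "pairs k \<subseteq> {1..k} \<times> {1..k}"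
    by (auto simp: pairs_def)
  then show ?thesis
    by (rule finite_subset) simp
qed

lemma in_pairsD:
  assumes "(i, j) \<in> pairs k"
  shows "i \<in> {1..k}" "j \<in> {1..k}" "i < j"
  using assms by (auto simp: pairs_def)

lemma sum_off_diagonal:
  fixes g :: "nat \<Rightarrow> nat \<Rightarrow> 'a::comm_ring_1"
  assumes sym: "\<And>i j. g i j = g j i"
  shows "(\<Sum>i\<in>{1..k}. \<Sum>j\<in>{1..k} - {i}. g i j) = 2 * (\<Sum>(i, j)\<in>pairs k. g i j)"
proof -
  have eq: "(SIGMA i:{1..k}. {1..k} - {i}) = pairs k \<union> prod.swap ` pairs k"
    by (auto simp: pairs_def image_iff)
  have "(\<Sum>i\<in>{1..k}. \<Sum>j\<in>{1..k} - {i}. g i j) = (\<Sum>(i, j)\<in>pairs k \<union> prod.swap ` pairs k. g i j)"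
    unfolding eq[symmetric] by (subst sum.Sigma) simp_all
  also have "\<dots> = (\<Sum>(i, j)\<in>pairs k. g i j) + (\<Sum>(i, j)\<in>prod.swap ` pairs k. g i j)"
  proof (rule sum.union_disjoint)
    show "pairs k \<inter> prod.swap ` pairs k = {}"
      by (auto simp: pairs_def)
  qed simp_all
  also have "(\<Sum>(i, j)\<in>prod.swap ` pairs k. g i j) = (\<Sum>(i, j)\<in>pairs k. g i j)"
    by (subst sum.reindex) (auto simp: case_prod_unfold sym intro!: sum.cong)
  finally show ?thesis
    by simp
qed

text \<open>Logarithmic derivatives add up over a product; the multipliers \<open>h x\<close> state
  this without division.\<close>

lemma leibniz_prod:
  fixes D :: "'a::comm_ring_1 \<Rightarrow> 'a"
  assumes "D 1 = 0" "\<And>p q. D (p * q) = D p * q + p * D q"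
    and "\<And>x. x \<in> F \<Longrightarrow> D (f x) = h x * f x" "finite F"
  shows "D (\<Prod>x\<in>F. f x) = (\<Sum>x\<in>F. h x) * (\<Prod>x\<in>F. f x)"
  using assms(4,3)
  by (induction F rule: finite_induct) (simp_all add: assms(1,2) algebra_simps)

text \<open>The vector field sends the factor \<open>z_i - z_j\<close> to \<open>c i - c j\<close>,
  which is a multiple of that factor by assumption, and the multipliers \<open>- g i j\<close> add
  up. The 2 compensates for summing over ordered pairs.\<close>

lemma vector_field_vandermonde:
  assumes "\<And>i j. i \<in> {1..k} \<Longrightarrow> j \<in> {1..k} \<Longrightarrow> c i - c j = - g i j * (indet i - indet j)"
    and sym: "\<And>i j. g i j = g j i"
  shows "2 * (\<Sum>i\<in>{1..k}. c i * partial_deriv i (vandermonde k)) =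
     - (\<Sum>i\<in>{1..k}. \<Sum>j\<in>{1..k} - {i}. g i j) * vandermonde k"
proof -
  define D where "D p = (\<Sum>i\<in>{1..k}. c i * partial_deriv i p)" for p
  have "D (case x of (i, j) \<Rightarrow> indet i - indet j) =
      (case x of (i, j) \<Rightarrow> - g i j) * (case x of (i, j) \<Rightarrow> indet i - indet j)"
    if x: "x \<in> pairs k" for x
  proof -
    obtain i j where ij: "x = (i, j)" by fastforce
    then have *: "i \<in> {1..k}" "j \<in> {1..k}"
      using x by (auto simp: pairs_def)
    have "D (indet i - indet j) = c i - c j"
      using * by (simp add: D_def partial_deriv_diff partial_deriv_indet right_diff_distrib
          sum_subtractf if_distrib[of "\<lambda>y. _ * y"] cong: if_cong)
    then show ?thesis
      using assms(1)[OF *] ij by simp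
  qed
  then have "D (vandermonde k) = (\<Sum>(i, j)\<in>pairs k. - g i j) * vandermonde k"
    unfolding vandermonde_def
    by (intro leibniz_prod)
      (simp_all add: D_def partial_deriv_mult sum.distrib sum_distrib_left sum_distrib_right
        algebra_simps)
  also have "(\<Sum>(i, j)\<in>pairs k. - g i j) = - (\<Sum>(i, j)\<in>pairs k. g i j)"
    by (simp add: sum_negf case_prod_unfold)
  finally show ?thesis
    unfolding sum_off_diagonal[where g = g, OF sym] D_def by simp
qed

lemma sum_sum_esym_remove:
  "(\<Sum>i\<in>{1..k}. \<Sum>j\<in>{1..k} - {i}. esym ({1..k} - {i} - {j}) c) =
     (of_nat k - of_nat c) * (of_nat k - of_nat c - 1) * esym {1..k} c"
proof -
  have "(\<Sum>j\<in>{1..k} - {i}. esym ({1..k} - {i} - {j}) c) =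
      (of_nat k - of_nat c - 1) * esym ({1..k} - {i}) c" if "i \<in> {1..k}" for i
  proof -
    have "card ({1..k} - {i}) = k - 1"
      using that by simp
    then have "(of_nat (card ({1..k} - {i})) :: cmpoly) = of_nat k - 1"
      using that by (simp only:) (simp add: of_nat_diff)
    moreover have "finite ({1..k} - {i})"
      by simp
    ultimately show ?thesis
      by (simp only: sum_esym_remove) (simp add: algebra_simps)
  qed
  then have "(\<Sum>i\<in>{1..k}. \<Sum>j\<in>{1..k} - {i}. esym ({1..k} - {i} - {j}) c) =
      (of_nat k - of_nat c - 1) * (\<Sum>i\<in>{1..k}. esym ({1..k} - {i}) c)"
    by (simp add: sum_distrib_left)
  then show ?thesis
    by (simp add: sum_esym_remove)
qed

text \<open>The sum on the left is the inner product of the gradients of \<open>e_(b+1)\<close> and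
  of the Vandermonde product. The components \<open>e_(c+1)(S - {i})\<close> and
  \<open>e_(c+1)(S - {j})\<close> differ by a multiple of \<open>z_i - z_j\<close>, as the expansion
  by the other variable shows. For \<open>b = 0\<close> the field generates translations and
  annihilates all differences.\<close>

lemma grad_esym_vandermonde:
  "2 * (\<Sum>i\<in>{1..k}. esym ({1..k} - {i}) b * partial_deriv i (vandermonde k)) =
     (case b of 0 \<Rightarrow> 0 | Suc c \<Rightarrow>
       - ((of_nat k - of_nat c) * (of_nat k - of_nat c - 1) * esym {1..k} c)) * vandermonde k"
proof (cases b)
  case 0
  then show ?thesis
    using vector_field_vandermonde[of k "\<lambda>i. esym ({1..k} - {i}) 0" "\<lambda>i j. 0"] by simp
next
  case (Suc c)
  have "2 * (\<Sum>i\<in>{1..k}. esym ({1..k} - {i}) (Suc c) * partial_deriv i (vandermonde k)) =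
     - (\<Sum>i\<in>{1..k}. \<Sum>j\<in>{1..k} - {i}. esym ({1..k} - {i} - {j}) c) * vandermonde k"
  proof (rule vector_field_vandermonde)
    fix i j assume ij: "i \<in> {1..k}" "j \<in> {1..k}"
    have *: "{1..k} - {i} - {j} = {1..k} - {j} - {i}"
      by blast
    show "esym ({1..k} - {i}) (Suc c) - esym ({1..k} - {j}) (Suc c) =
        - esym ({1..k} - {i} - {j}) c * (indet i - indet j)"
    proof (cases "i = j")
      case False
      then have "esym ({1..k} - {i}) (Suc c) =
          esym ({1..k} - {j} - {i}) (Suc c) + indet j * esym ({1..k} - {j} - {i}) c"
        "esym ({1..k} - {j}) (Suc c) =
          esym ({1..k} - {j} - {i}) (Suc c) + indet i * esym ({1..k} - {j} - {i}) c"
        using ij esym_remove[of "{1..k} - {i}" j c] esym_remove[of "{1..k} - {j}" i c]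
        unfolding * by blast+
      then show ?thesis
        unfolding * by algebra
    qed simp
  qed (simp add: Diff_insert2[symmetric] insert_commute)
  then show ?thesis
    unfolding sum_sum_esym_remove by (simp add: Suc)
qed

section \<open>Adjoining one variable to the Vandermonde product\<close>

lemma partial_deriv_vandermonde_greater:
  assumes "k < n"
  shows "partial_deriv n (vandermonde k) = 0"
proof -
  have "n \<noteq> i \<and> n \<noteq> j" if "(i, j) \<in> pairs k" for i j
    using in_pairsD[OF that] assms by auto
  note ne = this
  have "partial_deriv n (vandermonde k) = (\<Sum>x\<in>pairs k. 0) * vandermonde k"
    unfolding vandermonde_def
    by (rule leibniz_prod)
      (auto simp: partial_deriv_mult partial_deriv_diff partial_deriv_indet dest: ne)
  then show ?thesis by simp
qed

lemma partial_deriv_prod_diff: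
  assumes "finite S" "n \<notin> S" "i \<in> S"
  shows "partial_deriv i (\<Prod>j\<in>S. indet j - indet n) = (\<Prod>j\<in>S - {i}. indet j - indet n)"
proof -
  have "partial_deriv i (\<Prod>j\<in>S - {i}. indet j - indet n) =
      (\<Sum>j\<in>S - {i}. 0) * (\<Prod>j\<in>S - {i}. indet j - indet n)"
    by (rule leibniz_prod)
      (use assms in \<open>auto simp: partial_deriv_mult partial_deriv_diff partial_deriv_indet\<close>)
  then show ?thesis
    using assms
    by (subst prod.remove[of S i])
      (auto simp: partial_deriv_mult partial_deriv_diff partial_deriv_indet)
qed

lemma partial_deriv_prod_diff':
  "finite S \<Longrightarrow> n \<notin> S \<Longrightarrow>
    partial_deriv n (\<Prod>j\<in>S. indet j - indet n) = - (\<Sum>i\<in>S. \<Prod>j\<in>S - {i}. indet j - indet n)"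
proof (induction S rule: finite_induct)
  case (insert x S)
  have "insert x S - {i} = insert x (S - {i})" if "i \<in> S" for i
    using that insert by auto
  then show ?case
    using insert
    by (simp add: partial_deriv_mult partial_deriv_diff partial_deriv_indet sum_distrib_left)
qed simp

lemma partial_deriv_sq:
  "partial_deriv i (partial_deriv i (p * q)) =
     partial_deriv i (partial_deriv i p) * q + 2 * (partial_deriv i p * partial_deriv i q) +
     p * partial_deriv i (partial_deriv i q)"
  by (simp add: partial_deriv_mult partial_deriv_add algebra_simps)

text \<open>Induction on \<open>k\<close>. The new variable contributes the factor
  \<open>P {1..k}\<close>, which is affine in every old variable, so its pure second derivatives
  come from the new variable alone. They cancel against the cross terms of the product rule.\<close>

lemma laplacian_vandermonde: "laplacian {1..k} (vandermonde k) = 0"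
proof (induction k)
  case 0
  then show ?case by (simp add: laplacian_def)
next
  case (Suc k)
  define P where "P S = (\<Prod>j\<in>S. indet j - indet (Suc k))" for S
  define v where "v = vandermonde k"
  have "pairs (Suc k) = pairs k \<union> (\<lambda>i. (i, Suc k)) ` {1..k}"
    by (auto simp: pairs_def)
  moreover have "pairs k \<inter> (\<lambda>i. (i, Suc k)) ` {1..k} = {}"
    by (auto simp: pairs_def)
  moreover have "inj_on (\<lambda>i. (i, Suc k)) {1..k}"
    by (auto simp: inj_on_def)
  ultimately have vand: "vandermonde (Suc k) = v * P {1..k}"
    unfolding vandermonde_def v_def P_def by (simp add: prod.union_disjoint prod.reindex)
  have dP: "partial_deriv i (P {1..k}) = P ({1..k} - {i})" if "i \<in> {1..k}" for i
    using that unfolding P_def by (intro partial_deriv_prod_diff) auto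
  have ddP: "partial_deriv i (P ({1..k} - {i})) = 0" if "i \<in> {1..k}" for i
  proof -
    have "partial_deriv i (P ({1..k} - {i})) = (\<Sum>j\<in>{1..k} - {i}. 0) * P ({1..k} - {i})"
      unfolding P_def
      by (rule leibniz_prod)
        (use that in \<open>auto simp: partial_deriv_mult partial_deriv_diff partial_deriv_indet\<close>)
    then show ?thesis by simp
  qed
  have nP: "partial_deriv (Suc k) (partial_deriv (Suc k) (P {1..k})) =
      (\<Sum>i\<in>{1..k}. \<Sum>j\<in>{1..k} - {i}. P ({1..k} - {i} - {j}))"
    unfolding P_def
    by (simp add: partial_deriv_prod_diff' partial_deriv_uminus partial_deriv_sum sum_negf)
  \<comment> \<open>The cross terms: the components \<open>P ({1..k} - {i})\<close> of the vector
    field form the gradient of \<open>P {1..k}\<close> in the old variables.\<close>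
  have "2 * (\<Sum>i\<in>{1..k}. P ({1..k} - {i}) * partial_deriv i (vandermonde k)) =
     - (\<Sum>i\<in>{1..k}. \<Sum>j\<in>{1..k} - {i}. P ({1..k} - {i} - {j})) * vandermonde k"
  proof (rule vector_field_vandermonde)
    fix i j assume ij: "i \<in> {1..k}" "j \<in> {1..k}"
    have *: "{1..k} - {i} - {j} = {1..k} - {j} - {i}"
      by blast
    show "P ({1..k} - {i}) - P ({1..k} - {j}) =
        - P ({1..k} - {i} - {j}) * (indet i - indet j)"
    proof (cases "i = j")
      case False
      have "P ({1..k} - {i}) = (indet j - indet (Suc k)) * P ({1..k} - {i} - {j})"
        unfolding P_def by (rule prod.remove) (use False ij in auto)
      moreover have "P ({1..k} - {j}) = (indet i - indet (Suc k)) * P ({1..k} - {i} - {j})"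
        unfolding P_def * by (rule prod.remove) (use False ij in auto)
      ultimately show ?thesis
        by algebra
    qed simp
  qed (simp add: Diff_insert2[symmetric] insert_commute)
  then have cross: "2 * (\<Sum>i\<in>{1..k}. P ({1..k} - {i}) * partial_deriv i v) =
     - (\<Sum>i\<in>{1..k}. \<Sum>j\<in>{1..k} - {i}. P ({1..k} - {i} - {j})) * v"
    by (simp add: v_def)
  have "laplacian {1..Suc k} (vandermonde (Suc k)) =
      laplacian {1..k} v * P {1..k}
      + 2 * (\<Sum>i\<in>{1..k}. P ({1..k} - {i}) * partial_deriv i v)
      + v * (\<Sum>i\<in>{1..k}. \<Sum>j\<in>{1..k} - {i}. P ({1..k} - {i} - {j}))"
  proof -
    have "(\<Sum>i\<in>{1..k}. partial_deriv i (partial_deriv i (v * P {1..k}))) =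
        (\<Sum>i\<in>{1..k}. partial_deriv i (partial_deriv i v) * P {1..k}
          + 2 * (P ({1..k} - {i}) * partial_deriv i v))"
    proof (intro sum.cong refl)
      fix i assume i: "i \<in> {1..k}"
      show "partial_deriv i (partial_deriv i (v * P {1..k})) =
          partial_deriv i (partial_deriv i v) * P {1..k} +
          2 * (P ({1..k} - {i}) * partial_deriv i v)"
        unfolding partial_deriv_sq dP[OF i] ddP[OF i] by (simp add: mult.commute)
    qed
    moreover have "partial_deriv (Suc k) v = 0"
      by (simp add: v_def partial_deriv_vandermonde_greater)
    then have "partial_deriv (Suc k) (partial_deriv (Suc k) (v * P {1..k})) =
        v * (\<Sum>i\<in>{1..k}. \<Sum>j\<in>{1..k} - {i}. P ({1..k} - {i} - {j}))"
      by (simp add: partial_deriv_sq nP del: One_nat_def)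
    ultimately show ?thesis
      unfolding laplacian_def vand by (simp add: sum.distrib sum_distrib_right sum_distrib_left)
  qed
  also have "\<dots> = 0"
    using Suc.IH cross by (simp add: v_def)
  finally show ?case .
qed

section \<open>Positivity\<close>

lemma lookup_weighted_euler:
  "Poly_Mapping.lookup (weighted_euler w S p) m =
     of_nat (\<Sum>i\<in>S. w i * Poly_Mapping.lookup m i) * Poly_Mapping.lookup p m"
proof -
  have "Poly_Mapping.lookup (of_nat (w i) * (indet i * partial_deriv i p)) m =
      of_nat (w i * Poly_Mapping.lookup m i) * Poly_Mapping.lookup p m" for i
    by (simp only: const_poly_of_nat[symmetric] lookup_const_poly_mult
        lookup_indet_mult_partial_deriv) simp
  then show ?thesis
    by (simp add: weighted_euler_def lookup_sum sum_distrib_right)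
qed

text \<open>The eigenvalue of a monomial is its weighted degree, which is positive for every
  nonconstant monomial in \<open>S\<close>.\<close>

lemma weighted_euler_eq_0_imp_const:
  assumes "weighted_euler w S p = 0" "variables p \<subseteq> S" "finite S" "\<And>i. i \<in> S \<Longrightarrow> w i > 0"
  obtains c where "p = const_poly c"
proof -
  have "Poly_Mapping.lookup p m = 0" if "m \<noteq> 0" for m
  proof (rule ccontr)
    assume nz: "Poly_Mapping.lookup p m \<noteq> 0"
    obtain i where i: "i \<in> Poly_Mapping.keys m"
      using \<open>m \<noteq> 0\<close> keys_eq_empty[of m] by blast
    moreover have "m \<in> Poly_Mapping.keys p"
      using nz by (simp add: in_keys_iff)
    ultimately have "i \<in> S"
      using assms(2) unfolding variables_def by blast
    moreover have "(\<Sum>i\<in>S. w i * Poly_Mapping.lookup m i) = 0"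
      using nz assms(1) lookup_weighted_euler[of w S p m] by (simp del: of_nat_sum)
    ultimately show False
      using i assms(3) assms(4)[OF \<open>i \<in> S\<close>] by (auto simp: in_keys_iff)
  qed
  then show thesis
    using eq_const_polyI that by blast
qed

text \<open>Coefficients are complex by type, so reality has to be tracked for sums of squares to be
  positive.\<close>

definition real_coeffs :: "cmpoly \<Rightarrow> bool" where
  "real_coeffs p \<longleftrightarrow> (\<forall>m. Poly_Mapping.lookup p m \<in> \<real>)"

lemma real_coeffs_mult:
  assumes "real_coeffs p" "real_coeffs q"
  shows "real_coeffs (p * q)"
proof -
  let ?s = "\<lambda>p m. Poly_Mapping.single m (Poly_Mapping.lookup p m) :: cmpoly"
  have "real_coeffs ((\<Sum>m\<in>A. ?s p m) * (\<Sum>n\<in>B. ?s q n))" for A B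
    using assms unfolding real_coeffs_def sum_product lookup_sum
    by (auto simp: mult_single lookup_single when_def intro!: sum_in_Reals)
  from this[of "Poly_Mapping.keys p" "Poly_Mapping.keys q"] show ?thesis
    by (simp flip: cmpoly_as_sum)
qed

lemma real_coeffs_partial_deriv: "real_coeffs p \<Longrightarrow> real_coeffs (partial_deriv i p)"
  unfolding real_coeffs_def lookup_partial_deriv by (metis Reals_mult Reals_of_nat)

lemma real_coeffs_vandermonde: "real_coeffs (vandermonde k)"
proof -
  have "real_coeffs 1" "real_coeffs (indet i - indet j)" for i j
    by (auto simp: real_coeffs_def indet_def lookup_minus lookup_single lookup_one when_def)
  then have "real_coeffs (\<Prod>(i, j)\<in>A. indet i - indet j)" for A
    by (induction A rule: infinite_finite_induct) (auto intro: real_coeffs_mult)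
  then show ?thesis
    by (simp add: vandermonde_def)
qed

lemma variables_vandermonde: "variables (vandermonde k) \<subseteq> {1..k}"
proof -
  have "variables (\<Prod>(i, j)\<in>A. indet i - indet j) \<subseteq> {1..k}" if "A \<subseteq> pairs k" for A
    using that
  proof (induction A rule: infinite_finite_induct)
    case (insert x A)
    then obtain i j where ij: "x = (i, j)" "(i, j) \<in> pairs k"
      by (cases x) auto
    have "variables (indet i - indet j) \<subseteq> {1..k}"
      using variables_add[of "indet i" "- indet j"] in_pairsD[OF ij(2)] by auto
    then show ?case
      using insert ij variables_mult[of "indet i - indet j" "\<Prod>(i, j)\<in>A. indet i - indet j"]
      by auto
  qed auto
  then show ?thesis
    by (simp add: vandermonde_def)
qed

lemma vandermonde_nonzero: "vandermonde k \<noteq> 0"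
  by (auto simp: vandermonde_def dest: in_pairsD)

lemma weighted_euler_mult:
  "weighted_euler w S (p * q) = weighted_euler w S p * q + p * weighted_euler w S q"
  by (simp add: weighted_euler_def partial_deriv_mult sum.distrib sum_distrib_left
      sum_distrib_right algebra_simps)

lemma weighted_euler_vandermonde:
  "weighted_euler (\<lambda>_. 1) {1..k} (vandermonde k) = of_nat (card (pairs k)) * vandermonde k"
proof -
  have "weighted_euler (\<lambda>_. 1) {1..k} (vandermonde k) = (\<Sum>x\<in>pairs k. 1) * vandermonde k"
    unfolding vandermonde_def
  proof (rule leibniz_prod)
    fix x assume "x \<in> pairs k"
    then obtain i j where "x = (i, j)" "i \<in> {1..k}" "j \<in> {1..k}"
      using in_pairsD by (cases x) blast
    then show "weighted_euler (\<lambda>_. 1) {1..k} (case x of (i, j) \<Rightarrow> indet i - indet j) =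
        1 * (case x of (i, j) \<Rightarrow> indet i - indet j)"
      by (simp add: weighted_euler_def partial_deriv_diff partial_deriv_indet
          right_diff_distrib sum_subtractf if_distrib[of "\<lambda>y. _ * y"] cong: if_cong)
  qed (simp_all add: weighted_euler_mult, simp add: weighted_euler_def)
  then show ?thesis by simp
qed

section \<open>Iterated Laplacians of squares of harmonic polynomials\<close>

lemma laplacian_add: "laplacian S (p + q) = laplacian S p + laplacian S q"
  by (simp add: laplacian_def partial_deriv_add sum.distrib)

lemma laplacian_0 [simp]: "laplacian S 0 = 0"
  by (simp add: laplacian_def)

lemma funpow_laplacian_add:
  "(laplacian S ^^ n) (p + q) = (laplacian S ^^ n) p + (laplacian S ^^ n) q"
  by (induction n) (simp_all add: laplacian_add)

lemma funpow_laplacian_sum: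
  "(laplacian S ^^ n) (\<Sum>a\<in>A. f a) = (\<Sum>a\<in>A. (laplacian S ^^ n) (f a))"
proof -
  have "(laplacian S ^^ n) 0 = 0"
    by (induction n) simp_all
  then show ?thesis
    by (induction A rule: infinite_finite_induct) (simp_all add: funpow_laplacian_add)
qed

text \<open>For harmonic \<open>g\<close> only the cross terms of the product rule survive. Their
  factor 2 is written as two equal summands, to which the additivity of iterated Laplacians
  applies.\<close>

lemma laplacian_square:
  assumes "laplacian S g = 0"
  shows "laplacian S (g\<^sup>2) = (\<Sum>i\<in>S. (partial_deriv i g)\<^sup>2) + (\<Sum>i\<in>S. (partial_deriv i g)\<^sup>2)"
proof -
  have "laplacian S (g\<^sup>2) = 2 * (\<Sum>i\<in>S. (partial_deriv i g)\<^sup>2) + 2 * g * laplacian S g"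
    by (simp add: laplacian_def power2_eq_square partial_deriv_sq sum.distrib sum_distrib_left
        algebra_simps)
  then show ?thesis
    using assms by simp
qed

text \<open>\<open>r\<close> is \<open>2\<^sup>n\<close> times the sum of the squares of the derivatives of order \<open>n\<close>.\<close>

lemma funpow_laplacian_square_pos:
  assumes "finite S" "real_coeffs g" "variables g \<subseteq> S" "laplacian S g = 0" "g \<noteq> 0"
    and "weighted_euler (\<lambda>_. 1) S g = of_nat n * g"
  shows "\<exists>r>0. (laplacian S ^^ n) (g\<^sup>2) = const_poly (of_real r)"
  using assms(2-)
proof (induction n arbitrary: g)
  case 0
  obtain c where c: "g = const_poly c"
    by (rule weighted_euler_eq_0_imp_const[of "\<lambda>_. 1" S g]) (use 0 assms(1) in auto)
  have "c \<in> \<real>"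
    using 0(1) c unfolding real_coeffs_def const_poly_def by (metis lookup_single_eq)
  then obtain r where r: "c = of_real r"
    by (auto elim: Reals_cases)
  then have "r \<noteq> 0"
    using 0 c by auto
  then show ?case
    by (intro exI[of _ "r\<^sup>2"]) (simp add: c r power2_eq_square const_poly_mult zero_less_mult_iff, linarith)
next
  case (Suc n)
  define h where "h i = (laplacian S ^^ n) ((partial_deriv i g)\<^sup>2)" for i
  \<comment> \<open>Derivatives of a harmonic form are harmonic forms of one degree less, so the
    induction hypothesis covers each nonzero one.\<close>
  have pos: "\<exists>r>0. h i = const_poly (of_real r)" if i: "i \<in> S" "partial_deriv i g \<noteq> 0" for i
    unfolding h_def
  proof (rule Suc.IH)
    show "real_coeffs (partial_deriv i g)" "variables (partial_deriv i g) \<subseteq> S"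
      using Suc.prems variables_partial_deriv real_coeffs_partial_deriv by blast+
    have "laplacian S (partial_deriv i g) = partial_deriv i (laplacian S g)"
      by (simp add: laplacian_def partial_deriv_sum partial_deriv_commute)
    then show "laplacian S (partial_deriv i g) = 0"
      using Suc.prems by simp
    have "partial_deriv i (weighted_euler (\<lambda>_. 1) S g) =
        weighted_euler (\<lambda>_. 1) S (partial_deriv i g) + partial_deriv i g"
      using i(1) assms(1) by (simp add: weighted_euler_def partial_deriv_sum partial_deriv_mult
          partial_deriv_indet sum.distrib partial_deriv_commute
          if_distrib[of "\<lambda>y. y * _"] cong: if_cong)
    then show "weighted_euler (\<lambda>_. 1) S (partial_deriv i g) = of_nat n * partial_deriv i g"
      using Suc.prems by (simp add: partial_deriv_mult algebra_simps del: of_nat_Suc) (simp add: algebra_simps)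
  qed (use i in simp)
  have ex: "\<exists>r. h i = const_poly (of_real r) \<and> r \<ge> 0 \<and> (partial_deriv i g \<noteq> 0 \<longrightarrow> r > 0)"
    if "i \<in> S" for i
  proof (cases "partial_deriv i g = 0")
    case True
    have "(laplacian S ^^ m) 0 = 0" for m
      by (induction m) simp_all
    with True show ?thesis
      by (intro exI[of _ 0]) (simp add: h_def)
  next
    case False
    then show ?thesis
      using pos[OF that False] less_imp_le by blast
  qed
  then have "\<forall>i\<in>S. \<exists>r. h i = const_poly (of_real r) \<and> r \<ge> 0 \<and> (partial_deriv i g \<noteq> 0 \<longrightarrow> r > 0)"
    by blast
  then obtain r where r: "\<forall>i\<in>S. h i = const_poly (of_real (r i)) \<and> r i \<ge> 0 \<and>
      (partial_deriv i g \<noteq> 0 \<longrightarrow> r i > 0)"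
    by (rule bchoice[THEN exE])
  \<comment> \<open>By Euler's identity a form of positive degree with vanishing derivatives would
    itself be zero.\<close>
  obtain i where i: "i \<in> S" "partial_deriv i g \<noteq> 0"
  proof (rule ccontr)
    assume "\<not> thesis"
    then have "\<forall>i\<in>S. partial_deriv i g = 0"
      using that by blast
    then have "weighted_euler (\<lambda>_. 1) S g = 0"
      by (simp add: weighted_euler_def)
    then show False
      using Suc.prems by (simp del: of_nat_Suc)
  qed
  then have sum: "(\<Sum>i\<in>S. r i) > 0"
    using r assms(1) by (intro sum_pos2[of S i r]) auto
  have "(\<Sum>i\<in>A. h i) = const_poly (of_real (\<Sum>i\<in>A. r i))" if "A \<subseteq> S" for A
    using that r by (induction A rule: infinite_finite_induct) (auto simp: const_poly_add)
  then have hsum: "(\<Sum>i\<in>S. h i) = const_poly (of_real (\<Sum>i\<in>S. r i))"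
    by blast
  have "(laplacian S ^^ Suc n) (g\<^sup>2) = (laplacian S ^^ n) (laplacian S (g\<^sup>2))"
    by (simp add: funpow_swap1)
  also have "\<dots> = (\<Sum>i\<in>S. h i) + (\<Sum>i\<in>S. h i)"
    unfolding h_def laplacian_square[OF Suc.prems(3)] sum.distrib[symmetric] funpow_laplacian_sum
      funpow_laplacian_add ..
  also have "\<dots> = const_poly (of_real ((\<Sum>i\<in>S. r i) + (\<Sum>i\<in>S. r i)))"
    by (simp only: hsum of_real_add const_poly_add)
  finally show ?case
    using sum by (intro exI[of _ "(\<Sum>i\<in>S. r i) + (\<Sum>i\<in>S. r i)"]) simp
qed

lemma funpow_laplacian_vandermonde:
  "\<exists>r>0. (laplacian {1..k} ^^ card (pairs k)) ((vandermonde k)\<^sup>2) = const_poly (of_real r)"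
  by (rule funpow_laplacian_square_pos[OF _ real_coeffs_vandermonde variables_vandermonde
        laplacian_vandermonde vandermonde_nonzero weighted_euler_vandermonde]) simp

section \<open>The radial operators in the elementary symmetric coordinates\<close>

text \<open>The values outside \<open>1..k\<close> are those of the elementary symmetric polynomials
  of \<open>k\<close> variables, so the recursion for \<open>gram\<close> has no boundary
  cases.\<close>

definition sigma :: "nat \<Rightarrow> nat \<Rightarrow> cmpoly" where
  "sigma k a = (if a = 0 then 1 else if a \<le> k then indet a else 0)"

text \<open>\<open>gram k a b\<close> is the inner product of the gradients of the elementary symmetric polynomials
  of degrees \<open>a + 1\<close> and \<open>b + 1\<close>; the recursion is that of \<open>sum_esym_mult_esym_rec\<close>.
  Likewise \<open>drift k b\<close> is \<open>2 \<Sum>\<^bsub>i<j\<^esub> (\<partial>\<^sub>i - \<partial>\<^sub>j) / (z\<^sub>i - z\<^sub>j)\<close> applied to that of degree \<open>b + 1\<close>, so that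
  \<open>second_part k + \<kappa> first_part k\<close> is the operator \<open>L(\<kappa>)\<close>.\<close>

fun gram :: "nat \<Rightarrow> nat \<Rightarrow> nat \<Rightarrow> cmpoly" where
  "gram k 0 b = (of_nat k - of_nat b) * sigma k b"
| "gram k (Suc a) b = gram k a (Suc b)
     - ((of_nat k - of_nat a) * sigma k a * sigma k (Suc b) - (of_nat k - of_nat b) * sigma k b * sigma k (Suc a))"

definition drift :: "nat \<Rightarrow> nat \<Rightarrow> cmpoly" where
  "drift k b = (case b of 0 \<Rightarrow> 0 | Suc c \<Rightarrow>
     - ((of_nat k - of_nat c) * (of_nat k - of_nat c - 1) * sigma k c))"

definition second_part :: "nat \<Rightarrow> cmpoly \<Rightarrow> cmpoly" where
  "second_part k p =
     (\<Sum>a<k. \<Sum>b<k. gram k a b * partial_deriv (Suc a) (partial_deriv (Suc b) p))"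

definition first_part :: "nat \<Rightarrow> cmpoly \<Rightarrow> cmpoly" where
  "first_part k p = (\<Sum>b<k. drift k b * partial_deriv (Suc b) p)"

abbreviation to_z :: "nat \<Rightarrow> cmpoly \<Rightarrow> cmpoly" where
  "to_z k \<equiv> substitute (elem_sym k)"

lemma substitute_sigma [simp]: "to_z k (sigma k a) = esym {1..k} a"
  by (auto simp: sigma_def elem_sym_eq_esym esym_eq_0)

lemma substitute_gram:
  "to_z k (gram k a b) = (\<Sum>i\<in>{1..k}. esym ({1..k} - {i}) a * esym ({1..k} - {i}) b)"
proof (induction a arbitrary: b)
  case 0
  have "(\<Sum>i\<in>{1..k}. esym ({1..k} - {i}) 0 * esym ({1..k} - {i}) b) =
      (\<Sum>i\<in>{1..k}. esym ({1..k} - {i}) b)"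
    by simp
  then show ?case
    by (simp only: sum_esym_remove finite_atLeastAtMost) (simp add: substitute_mult substitute_diff)
next
  case (Suc a)
  have "(\<Sum>i\<in>{1..k}. esym ({1..k} - {i}) (Suc a) * esym ({1..k} - {i}) b) =
      to_z k (gram k a (Suc b))
      - ((of_nat k - of_nat a) * esym {1..k} a * esym {1..k} (Suc b)
        - (of_nat k - of_nat b) * esym {1..k} b * esym {1..k} (Suc a))"
    by (simp only: sum_esym_mult_esym_rec finite_atLeastAtMost Suc.IH) simp
  then show ?case
    by (simp only: gram.simps substitute_diff substitute_mult substitute_of_nat substitute_sigma)
qed

lemma substitute_drift:
  "to_z k (drift k b) = (case b of 0 \<Rightarrow> 0 | Suc c \<Rightarrow>
     - ((of_nat k - of_nat c) * (of_nat k - of_nat c - 1) * esym {1..k} c))"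
  by (cases b) (simp_all add: drift_def substitute_uminus substitute_mult substitute_diff)

section \<open>The operators stay within the variables \<open>1..k\<close>\<close>

lemma variables_sum:
  "(\<And>a. a \<in> I \<Longrightarrow> variables (f a) \<subseteq> A) \<Longrightarrow> variables (\<Sum>a\<in>I. f a) \<subseteq> A"
proof (induction I rule: infinite_finite_induct)
  case (insert x F)
  then show ?case
    using variables_add[of "f x" "\<Sum>a\<in>F. f a"] by auto
qed simp_all

lemma variables_mult_subset: "variables p \<subseteq> A \<Longrightarrow> variables q \<subseteq> A \<Longrightarrow> variables (p * q) \<subseteq> A"
  using variables_mult[of p q] by blast

lemma variables_add_subset: "variables p \<subseteq> A \<Longrightarrow> variables q \<subseteq> A \<Longrightarrow> variables (p + q) \<subseteq> A"
  using variables_add[of p q] by blast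

lemma variables_diff_subset: "variables p \<subseteq> A \<Longrightarrow> variables q \<subseteq> A \<Longrightarrow> variables (p - q) \<subseteq> A"
  using variables_add[of p "- q"] by auto

lemma variables_partial_deriv_subset: "variables p \<subseteq> A \<Longrightarrow> variables (partial_deriv i p) \<subseteq> A"
  using variables_partial_deriv[of i p] by blast

lemma variables_of_nat [simp]: "variables (of_nat n) = {}"
  by (simp flip: const_poly_of_nat)

lemmas variables_subsetI = variables_sum variables_mult_subset variables_add_subset
  variables_diff_subset variables_partial_deriv_subset

lemma variables_sigma: "variables (sigma k a) \<subseteq> {1..k}"
  by (auto simp: sigma_def)

lemma variables_gram: "variables (gram k a b) \<subseteq> {1..k}"
proof (induction a arbitrary: b)
  case 0
  show ?case
    unfolding gram.simps by (intro variables_subsetI variables_sigma) simp_all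
next
  case (Suc a)
  show ?case
    unfolding gram.simps by (intro variables_subsetI variables_sigma Suc.IH) simp_all
qed

lemma variables_drift: "variables (drift k b) \<subseteq> {1..k}"
proof (cases b)
  case (Suc c)
  have "variables ((of_nat k - of_nat c) * (of_nat k - of_nat c - 1) * sigma k c) \<subseteq> {1..k}"
    by (intro variables_subsetI variables_sigma) simp_all
  then show ?thesis
    by (simp add: drift_def Suc)
qed (simp add: drift_def)

lemma variables_second_part: "variables p \<subseteq> {1..k} \<Longrightarrow> variables (second_part k p) \<subseteq> {1..k}"
  unfolding second_part_def by (intro variables_subsetI variables_gram)

lemma variables_first_part: "variables p \<subseteq> {1..k} \<Longrightarrow> variables (first_part k p) \<subseteq> {1..k}"
  unfolding first_part_def by (intro variables_subsetI variables_drift)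

lemma partial_deriv_to_z:
  assumes "variables p \<subseteq> {1..k}" "i \<in> {1..k}"
  shows "partial_deriv i (to_z k p) =
     (\<Sum>a<k. to_z k (partial_deriv (Suc a) p) * esym ({1..k} - {i}) a)"
  using partial_deriv_substitute[OF _ assms(1), of i "elem_sym k"]
    sum_partial_deriv_esym[OF assms(2), of "\<lambda>a. to_z k (partial_deriv a p)"]
  by (simp add: elem_sym_eq_esym)

text \<open>First-order terms of the transformed Laplacian could only come from second derivatives
  of the \<open>e_a\<close> in a single \<open>z_i\<close>, and these vanish because
  \<open>e_a\<close> is affine in each variable. What remains is the Gram matrix of the
  gradients.\<close>

lemma to_z_second_part:
  assumes p: "variables p \<subseteq> {1..k}"
  shows "to_z k (second_part k p) = laplacian {1..k} (to_z k p)"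
proof -
  let ?e = "\<lambda>i a. esym ({1..k} - {i}) a"
  have "partial_deriv i (partial_deriv i (to_z k p)) = (\<Sum>a<k. \<Sum>b<k.
      ?e i a * ?e i b * to_z k (partial_deriv (Suc a) (partial_deriv (Suc b) p)))"
    if i: "i \<in> {1..k}" for i
  proof -
    have "partial_deriv i (partial_deriv i (to_z k p)) =
        (\<Sum>b<k. partial_deriv i (to_z k (partial_deriv (Suc b) p)) * ?e i b)"
      unfolding partial_deriv_to_z[OF p i]
      by (simp add: partial_deriv_sum partial_deriv_mult partial_deriv_esym_notin)
    also have "\<dots> = (\<Sum>b<k. \<Sum>a<k.
        ?e i a * ?e i b * to_z k (partial_deriv (Suc a) (partial_deriv (Suc b) p)))"
      unfolding partial_deriv_to_z[OF variables_partial_deriv_subset[OF p] i]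
      by (simp add: sum_distrib_left sum_distrib_right algebra_simps)
    also have "\<dots> = (\<Sum>a<k. \<Sum>b<k.
        ?e i a * ?e i b * to_z k (partial_deriv (Suc a) (partial_deriv (Suc b) p)))"
      by (rule sum.swap)
    finally show ?thesis .
  qed
  then have "laplacian {1..k} (to_z k p) = (\<Sum>i\<in>{1..k}. \<Sum>a<k. \<Sum>b<k.
      ?e i a * ?e i b * to_z k (partial_deriv (Suc a) (partial_deriv (Suc b) p)))"
    unfolding laplacian_def by (rule sum.cong[OF refl])
  also have "\<dots> = (\<Sum>a<k. \<Sum>i\<in>{1..k}. \<Sum>b<k.
      ?e i a * ?e i b * to_z k (partial_deriv (Suc a) (partial_deriv (Suc b) p)))"
    by (rule sum.swap)
  also have "\<dots> = (\<Sum>a<k. \<Sum>b<k. \<Sum>i\<in>{1..k}.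
      ?e i a * ?e i b * to_z k (partial_deriv (Suc a) (partial_deriv (Suc b) p)))"
    by (intro sum.cong refl sum.swap)
  finally show ?thesis
    unfolding second_part_def substitute_sum substitute_mult substitute_gram sum_distrib_right
    by (rule sym)
qed

text \<open>Squaring doubles the logarithmic derivative, which absorbs the factor 2 of
  \<open>grad_esym_vandermonde\<close>; the multiplier left over is \<open>drift\<close>.\<close>

lemma grad_vandermonde_sq:
  "(\<Sum>i\<in>{1..k}. esym ({1..k} - {i}) b * partial_deriv i ((vandermonde k)\<^sup>2)) =
     to_z k (drift k b) * (vandermonde k)\<^sup>2"
proof -
  have "(\<Sum>i\<in>{1..k}. esym ({1..k} - {i}) b * partial_deriv i ((vandermonde k)\<^sup>2)) =
      (2 * (\<Sum>i\<in>{1..k}. esym ({1..k} - {i}) b * partial_deriv i (vandermonde k))) * vandermonde k"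
    by (simp add: power2_eq_square partial_deriv_mult sum_distrib_left sum_distrib_right algebra_simps)
  then show ?thesis
    unfolding grad_esym_vandermonde substitute_drift by (simp add: power2_eq_square)
qed

text \<open>Hidden by the recursion, but clear in \<open>z\<close>, where the entries are inner
  products.\<close>

lemma gram_commute: "gram k a b = gram k b a"
  by (rule substitute_elem_sym_inject[OF variables_gram variables_gram])
    (simp add: substitute_gram mult.commute del: One_nat_def)

section \<open>The two differential identities for the discriminant\<close>

context
  fixes k :: nat and f :: cmpoly
  assumes vars_f: "variables f \<subseteq> {1..k}" and to_z_f: "to_z k f = (vandermonde k)\<^sup>2"
begin

lemma discriminant_nonzero: "f \<noteq> 0"
  using to_z_f vandermonde_nonzero[of k] by auto

text \<open>By the chain rule the left side becomes in \<open>z\<close> the inner product of the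
  gradients of \<open>e_(b+1)\<close> and of the squared Vandermonde product, which
  \<open>grad_vandermonde_sq\<close> evaluates.\<close>

lemma sum_gram_partial_deriv: "(\<Sum>a<k. gram k a b * partial_deriv (Suc a) f) = drift k b * f"
proof (rule substitute_elem_sym_inject)
  have "to_z k (\<Sum>a<k. gram k a b * partial_deriv (Suc a) f) =
      (\<Sum>a<k. \<Sum>i\<in>{1..k}. esym ({1..k} - {i}) b *
        (to_z k (partial_deriv (Suc a) f) * esym ({1..k} - {i}) a))"
    unfolding substitute_sum substitute_mult substitute_gram sum_distrib_right
    by (simp add: algebra_simps)
  also have "\<dots> = (\<Sum>i\<in>{1..k}. \<Sum>a<k. esym ({1..k} - {i}) b *
        (to_z k (partial_deriv (Suc a) f) * esym ({1..k} - {i}) a))"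
    by (rule sum.swap)
  also have "\<dots> = (\<Sum>i\<in>{1..k}. esym ({1..k} - {i}) b * partial_deriv i (to_z k f))"
    by (intro sum.cong refl) (simp only: partial_deriv_to_z[OF vars_f] sum_distrib_left)
  also have "\<dots> = to_z k (drift k b * f)"
    unfolding to_z_f grad_vandermonde_sq by (simp add: substitute_mult to_z_f)
  finally show "to_z k (\<Sum>a<k. gram k a b * partial_deriv (Suc a) f) = to_z k (drift k b * f)" .
qed (intro variables_subsetI variables_gram variables_drift vars_f)+

text \<open>Let \<open>v\<close> be the Vandermonde product. As \<open>v\<close> is harmonic, the
  Laplacian of \<open>v^2\<close> is \<open>2 |grad v|^2\<close>, whereas
  \<open>|grad v^2|^2 = 4 v^2 |grad v|^2\<close>; the latter is also \<open>v^2\<close> times the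
  image of \<open>first_part k f\<close>. In other words, \<open>L(-1/2)\<close> annihilates the
  discriminant.\<close>

lemma second_part_discriminant: "2 * second_part k f = first_part k f"
proof (rule substitute_elem_sym_inject)
  let ?v = "vandermonde k"
  \<comment> \<open>The extra factor \<open>?v^2\<close> turns each drift term into an inner product
    of gradients; it is cancelled at the end because \<open>?v\<close> is nonzero.\<close>
  have "?v\<^sup>2 * to_z k (first_part k f) =
      (\<Sum>b<k. to_z k (drift k b) * ?v\<^sup>2 * to_z k (partial_deriv (Suc b) f))"
    unfolding first_part_def substitute_sum substitute_mult sum_distrib_left
    by (simp add: algebra_simps)
  also have "\<dots> = (\<Sum>b<k. \<Sum>i\<in>{1..k}. partial_deriv i (?v\<^sup>2) *
      (to_z k (partial_deriv (Suc b) f) * esym ({1..k} - {i}) b))"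
    unfolding grad_vandermonde_sq[symmetric] sum_distrib_right
    by (simp add: algebra_simps)
  also have "\<dots> = (\<Sum>i\<in>{1..k}. \<Sum>b<k. partial_deriv i (?v\<^sup>2) *
      (to_z k (partial_deriv (Suc b) f) * esym ({1..k} - {i}) b))"
    by (rule sum.swap)
  also have "\<dots> = (\<Sum>i\<in>{1..k}. partial_deriv i (?v\<^sup>2) * partial_deriv i (to_z k f))"
    by (intro sum.cong refl) (simp only: partial_deriv_to_z[OF vars_f] sum_distrib_left)
  also have "\<dots> = ?v\<^sup>2 * (2 * laplacian {1..k} (?v\<^sup>2))"
  proof -
    have "partial_deriv i (?v\<^sup>2) * partial_deriv i (?v\<^sup>2) = ?v\<^sup>2 * 4 * (partial_deriv i ?v)\<^sup>2" for i
      by (simp add: power2_eq_square partial_deriv_mult algebra_simps)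
    then show ?thesis
      unfolding laplacian_square[OF laplacian_vandermonde] to_z_f
      by (simp only: sum_distrib_left[symmetric]) (simp add: algebra_simps)
  qed
  also have "\<dots> = ?v\<^sup>2 * to_z k (2 * second_part k f)"
    unfolding mult_2 substitute_add to_z_second_part[OF vars_f] to_z_f ..
  finally show "to_z k (2 * second_part k f) = to_z k (first_part k f)"
    using vandermonde_nonzero[of k] by simp
  have "variables (2 * second_part k f) \<subseteq> {1..k}"
    unfolding mult_2 by (intro variables_subsetI variables_second_part vars_f)
  then show "variables (2 * second_part k f) \<subseteq> {1..k}" .
qed (intro variables_first_part vars_f)

end

text \<open>Degrees are counted with \<open>sigma_a\<close> in degree \<open>a\<close>. Integers
  allow derivatives to lower them below 0, where only the zero polynomial is homogeneous.\<close>

definition homogeneous :: "nat \<Rightarrow> int \<Rightarrow> cmpoly \<Rightarrow> bool" where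
  "homogeneous k d p \<longleftrightarrow> weighted_euler (\<lambda>a. a) {1..k} p = of_int d * p"

lemma weighted_euler_add:
  "weighted_euler w S (p + q) = weighted_euler w S p + weighted_euler w S q"
  by (simp add: weighted_euler_def partial_deriv_add sum.distrib algebra_simps)

lemma weighted_euler_0 [simp]: "weighted_euler w S 0 = 0"
  by (simp add: weighted_euler_def)

lemma homogeneous_0 [simp]: "homogeneous k d 0"
  by (simp add: homogeneous_def)

lemma homogeneous_add: "homogeneous k d p \<Longrightarrow> homogeneous k d q \<Longrightarrow> homogeneous k d (p + q)"
  by (simp add: homogeneous_def weighted_euler_add algebra_simps)

lemma homogeneous_mult:
  "homogeneous k d p \<Longrightarrow> homogeneous k e q \<Longrightarrow> homogeneous k (d + e) (p * q)"
  by (simp add: homogeneous_def weighted_euler_mult algebra_simps)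

lemma homogeneous_const: "homogeneous k 0 (const_poly c)"
  by (simp add: homogeneous_def weighted_euler_def)

lemma homogeneous_of_nat: "homogeneous k 0 (of_nat c)"
  using homogeneous_const[of k "of_nat c"] by (simp add: const_poly_of_nat)

lemma homogeneous_uminus: "homogeneous k d p \<Longrightarrow> homogeneous k d (- p)"
  using homogeneous_mult[OF homogeneous_const[of k "-1"], of d p] by (simp add: const_poly_uminus)

lemma homogeneous_diff: "homogeneous k d p \<Longrightarrow> homogeneous k d q \<Longrightarrow> homogeneous k d (p - q)"
  using homogeneous_add[of k d p "- q"] homogeneous_uminus[of k d q] by simp

lemma homogeneous_sum:
  "(\<And>a. a \<in> I \<Longrightarrow> homogeneous k d (f a)) \<Longrightarrow> homogeneous k d (\<Sum>a\<in>I. f a)"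
  by (induction I rule: infinite_finite_induct) (auto intro: homogeneous_add)

lemma homogeneous_scalar_mult: "homogeneous k 0 c \<Longrightarrow> homogeneous k d p \<Longrightarrow> homogeneous k d (c * p)"
  using homogeneous_mult[of k 0 c d p] by simp

lemma homogeneous_sigma: "homogeneous k (int a) (sigma k a)"
  using homogeneous_const[of k 1]
  by (auto simp: sigma_def homogeneous_def weighted_euler_def partial_deriv_indet
      if_distrib[of "\<lambda>y. _ * y"] cong: if_cong)

lemma homogeneous_gram: "homogeneous k (int a + int b) (gram k a b)"
proof (induction a arbitrary: b)
  case 0
  then show ?case
    by (auto intro!: homogeneous_scalar_mult homogeneous_diff homogeneous_of_nat homogeneous_sigma)
next
  case (Suc a)
  have "homogeneous k (int a + int (Suc b)) (sigma k a * sigma k (Suc b))"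
    "homogeneous k (int b + int (Suc a)) (sigma k b * sigma k (Suc a))"
    by (intro homogeneous_mult homogeneous_sigma)+
  then have "homogeneous k (int (Suc a) + int b) ((of_nat k - of_nat a) * (sigma k a * sigma k (Suc b)))"
    "homogeneous k (int (Suc a) + int b) ((of_nat k - of_nat b) * (sigma k b * sigma k (Suc a)))"
    by (auto intro!: homogeneous_scalar_mult homogeneous_diff homogeneous_of_nat simp: add_ac)
  then show ?case
    using Suc.IH[of "Suc b"] by (auto intro!: homogeneous_diff simp: mult.assoc add_ac)
qed

lemma homogeneous_drift: "homogeneous k (int b - 1) (drift k b)"
proof (cases b)
  case (Suc c)
  have "homogeneous k (int c) ((of_nat k - of_nat c) * (of_nat k - of_nat c - of_nat 1) * sigma k c)"
    by (rule homogeneous_scalar_mult[OF homogeneous_scalar_mult homogeneous_sigma];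
        intro homogeneous_diff homogeneous_of_nat)
  then show ?thesis
    using homogeneous_uminus by (simp add: drift_def Suc)
qed (simp add: drift_def)

text \<open>The commutator of this derivative with the Euler operator is \<open>a + 1\<close> times
  the derivative.\<close>

lemma homogeneous_partial_deriv:
  assumes "homogeneous k d p" "a < k"
  shows "homogeneous k (d - (int a + 1)) (partial_deriv (Suc a) p)"
proof -
  have "partial_deriv (Suc a) (weighted_euler (\<lambda>a. a) {1..k} p) =
      weighted_euler (\<lambda>a. a) {1..k} (partial_deriv (Suc a) p) + of_nat (Suc a) * partial_deriv (Suc a) p"
  proof -
    have "partial_deriv (Suc a) (of_nat i * (indet i * partial_deriv i p)) =
        of_nat i * (indet i * partial_deriv i (partial_deriv (Suc a) p)) +
        (if i = Suc a then of_nat (Suc a) * partial_deriv (Suc a) p else 0)" for i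
      by (simp add: partial_deriv_mult partial_deriv_indet partial_deriv_commute algebra_simps
          del: of_nat_Suc)
    then show ?thesis
      using assms(2) by (simp add: weighted_euler_def partial_deriv_sum sum.distrib del: of_nat_Suc)
  qed
  moreover have "partial_deriv i (of_int e * p) = of_int e * partial_deriv i p" for i e
  proof -
    have "partial_deriv i (of_int e) = 0"
      by (cases e) (simp_all add: partial_deriv_uminus del: of_nat_Suc)
    then show ?thesis
      by (simp add: partial_deriv_mult)
  qed
  ultimately show ?thesis
    using assms(1) by (simp add: homogeneous_def algebra_simps)
qed

lemma homogeneous_second_part:
  assumes "homogeneous k d p"
  shows "homogeneous k (d - 2) (second_part k p)"
  unfolding second_part_def
proof (intro homogeneous_sum)
  fix a b assume "a \<in> {..<k}" "b \<in> {..<k}"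
  then have "homogeneous k (d - (int b + 1) - (int a + 1)) (partial_deriv (Suc a) (partial_deriv (Suc b) p))"
    using assms by (intro homogeneous_partial_deriv) auto
  from homogeneous_mult[OF homogeneous_gram[of k a b] this]
  show "homogeneous k (d - 2) (gram k a b * partial_deriv (Suc a) (partial_deriv (Suc b) p))"
    by (simp add: algebra_simps)
qed

lemma homogeneous_first_part:
  assumes "homogeneous k d p"
  shows "homogeneous k (d - 2) (first_part k p)"
  unfolding first_part_def
proof (intro homogeneous_sum)
  fix b assume "b \<in> {..<k}"
  then have "homogeneous k (d - (int b + 1)) (partial_deriv (Suc b) p)"
    using assms by (intro homogeneous_partial_deriv) auto
  from homogeneous_mult[OF homogeneous_drift[of k b] this]
  show "homogeneous k (d - 2) (drift k b * partial_deriv (Suc b) p)"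
    by (simp add: algebra_simps)
qed

text \<open>The weight of \<open>sigma_a\<close> is the degree of \<open>e_a\<close> in
  \<open>z\<close>, which enters through \<open>euler_esym\<close>.\<close>

lemma to_z_weighted_euler:
  assumes p: "variables p \<subseteq> {1..k}"
  shows "to_z k (weighted_euler (\<lambda>a. a) {1..k} p) = weighted_euler (\<lambda>_. 1) {1..k} (to_z k p)"
proof -
  have "weighted_euler (\<lambda>_. 1) {1..k} (to_z k p) =
      (\<Sum>i\<in>{1..k}. \<Sum>a<k. to_z k (partial_deriv (Suc a) p) * (indet i * esym ({1..k} - {i}) a))"
    unfolding weighted_euler_def
    by (intro sum.cong refl)
      (simp add: partial_deriv_to_z[OF p] sum_distrib_left algebra_simps del: One_nat_def)
  also have "\<dots> = (\<Sum>a<k. \<Sum>i\<in>{1..k}.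
      to_z k (partial_deriv (Suc a) p) * (indet i * esym ({1..k} - {i}) a))"
    by (rule sum.swap)
  also have "\<dots> = (\<Sum>a<k. to_z k (partial_deriv (Suc a) p) * (of_nat (Suc a) * esym {1..k} (Suc a)))"
    unfolding sum_distrib_left[symmetric] by (simp only: euler_esym finite_atLeastAtMost)
  also have "\<dots> = to_z k (weighted_euler (\<lambda>a. a) {1..k} p)"
    unfolding weighted_euler_def One_nat_def sum.atLeast1_atMost_eq
    by (simp add: substitute_sum substitute_mult elem_sym_eq_esym algebra_simps del: of_nat_Suc)
  finally show ?thesis ..
qed

lemma homogeneous_discriminant:
  assumes "variables f \<subseteq> {1..k}" "to_z k f = (vandermonde k)\<^sup>2"
  shows "homogeneous k (2 * int (card (pairs k))) f"
  unfolding homogeneous_def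
proof (rule substitute_elem_sym_inject)
  show "variables (weighted_euler (\<lambda>a. a) {1..k} f) \<subseteq> {1..k}"
    unfolding weighted_euler_def using assms(1)
    by (intro variables_sum variables_mult_subset variables_partial_deriv_subset) auto
  have e: "of_int (2 * int n) = (of_nat n + of_nat n :: cmpoly)" for n
    by simp
  show "variables (of_int (2 * int (card (pairs k))) * f) \<subseteq> {1..k}"
    unfolding e by (intro variables_mult_subset variables_add_subset assms(1)) auto
  show "to_z k (weighted_euler (\<lambda>a. a) {1..k} f) = to_z k (of_int (2 * int (card (pairs k))) * f)"
    unfolding e to_z_weighted_euler[OF assms(1)] assms(2) substitute_mult power2_eq_square
      weighted_euler_mult weighted_euler_vandermonde substitute_add substitute_of_nat
    by (simp add: algebra_simps)
qed

section \<open>The action on powers of the discriminant\<close>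

lemma fract_deriv_to_fract [simp]: "fract_deriv i (to_fract p) = to_fract (partial_deriv i p)"
  by (simp add: to_fract_def fract_deriv_Fract)

lemma fract_deriv_0 [simp]: "fract_deriv i 0 = 0"
  using fract_deriv_to_fract[of i 0] by simp

lemma fract_deriv_add: "fract_deriv i (x + y) = fract_deriv i x + fract_deriv i y"
proof (cases x, cases y)
  fix a b c d :: cmpoly
  assume x: "x = Fract a b" "b \<noteq> 0" and y: "y = Fract c d" "d \<noteq> 0"
  then show ?thesis
    by (simp add: fract_deriv_Fract eq_fract partial_deriv_mult partial_deriv_add)
      (simp add: algebra_simps)
qed

lemma fract_deriv_mult: "fract_deriv i (x * y) = fract_deriv i x * y + x * fract_deriv i y"
proof (cases x, cases y)
  fix a b c d :: cmpoly
  assume x: "x = Fract a b" "b \<noteq> 0" and y: "y = Fract c d" "d \<noteq> 0"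
  then show ?thesis
    by (simp add: fract_deriv_Fract eq_fract partial_deriv_mult)
      (simp add: algebra_simps)
qed

lemma map_poly_additive:
  fixes D :: "'a::comm_monoid_add \<Rightarrow> 'b::comm_monoid_add"
  assumes "D 0 = 0" "\<And>x y. D (x + y) = D x + D y"
  shows "map_poly D (p + q) = map_poly D p + map_poly D q"
  by (rule poly_eqI) (simp add: coeff_map_poly assms)

lemma fract_poly_sum: "fract_poly (\<Sum>a\<in>I. f a) = (\<Sum>a\<in>I. fract_poly (f a))"
  by (induction I rule: infinite_finite_induct) (simp_all add: fract_poly_add)

text \<open>The computation behind the conjugation, isolated in a commutative ring. \<open>G\<close>
  and \<open>B\<close> stand for \<open>gram\<close> and \<open>drift\<close>, \<open>U\<close> and
  \<open>W\<close> for the first and second derivatives of \<open>f\<close> divided by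
  \<open>f\<close>, \<open>H\<close>, \<open>H1\<close> and \<open>H2\<close> for the coefficient
  and its derivatives, \<open>S\<close> for \<open>s\<close> and \<open>h\<close> for 1/2. The left
  side is \<open>L(1/2 - s)\<close> applied to \<open>H f^s\<close>, the right side is
  \<open>L(1/2 + s)\<close> applied to \<open>H\<close>.\<close>

lemma sum_radial_identity:
  fixes G :: "nat \<Rightarrow> nat \<Rightarrow> 'a::comm_ring_1"
  assumes GU: "\<And>b. b \<in> I \<Longrightarrow> (\<Sum>a\<in>I. G a b * U a) = B b"
    and sym: "\<And>a b. G a b = G b a"
    and W: "2 * (\<Sum>a\<in>I. \<Sum>b\<in>I. G a b * W a b) = (\<Sum>b\<in>I. B b * U b)"
    and half: "2 * h = 1"
  shows "(\<Sum>a\<in>I. \<Sum>b\<in>I. G a b * (H2 a b + S * ((W a b - U a * U b) * H + U b * H1 a) +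
      S * U a * (H1 b + S * U b * H))) + (h - S) * (\<Sum>b\<in>I. B b * (H1 b + S * U b * H)) =
    (\<Sum>a\<in>I. \<Sum>b\<in>I. G a b * H2 a b) + (h + S) * (\<Sum>b\<in>I. B b * H1 b)"
proof -
  have UU: "(\<Sum>a\<in>I. \<Sum>b\<in>I. G a b * (U a * U b)) = (\<Sum>b\<in>I. B b * U b)"
  proof -
    have "(\<Sum>a\<in>I. \<Sum>b\<in>I. G a b * (U a * U b)) = (\<Sum>b\<in>I. \<Sum>a\<in>I. G a b * (U a * U b))"
      by (rule sum.swap)
    also have "\<dots> = (\<Sum>b\<in>I. (\<Sum>a\<in>I. G a b * U a) * U b)"
      by (simp add: sum_distrib_right mult.assoc)
    finally show ?thesis
      using GU by simp
  qed
  have UH: "(\<Sum>a\<in>I. \<Sum>b\<in>I. G a b * (U a * H1 b)) = (\<Sum>b\<in>I. B b * H1 b)"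
  proof -
    have "(\<Sum>a\<in>I. \<Sum>b\<in>I. G a b * (U a * H1 b)) = (\<Sum>b\<in>I. \<Sum>a\<in>I. G a b * (U a * H1 b))"
      by (rule sum.swap)
    also have "\<dots> = (\<Sum>b\<in>I. (\<Sum>a\<in>I. G a b * U a) * H1 b)"
      by (simp add: sum_distrib_right mult.assoc)
    finally show ?thesis
      using GU by simp
  qed
  have HU: "(\<Sum>a\<in>I. \<Sum>b\<in>I. G a b * (U b * H1 a)) = (\<Sum>b\<in>I. B b * H1 b)"
  proof -
    have "(\<Sum>a\<in>I. \<Sum>b\<in>I. G a b * (U b * H1 a)) = (\<Sum>a\<in>I. (\<Sum>b\<in>I. G b a * U b) * H1 a)"
      by (simp add: sum_distrib_right mult.assoc sym)
    then show ?thesis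
      using GU by simp
  qed
  have "(\<Sum>a\<in>I. \<Sum>b\<in>I. G a b * (H2 a b + S * ((W a b - U a * U b) * H + U b * H1 a) +
      S * U a * (H1 b + S * U b * H))) =
    (\<Sum>a\<in>I. \<Sum>b\<in>I. G a b * H2 a b + S * H * (G a b * W a b) - S * H * (G a b * (U a * U b)) +
      S * (G a b * (U b * H1 a)) + S * (G a b * (U a * H1 b)) + S * S * H * (G a b * (U a * U b)))"
    by (intro sum.cong refl) (simp add: algebra_simps)
  also have "\<dots> = (\<Sum>a\<in>I. \<Sum>b\<in>I. G a b * H2 a b) + S * H * (\<Sum>a\<in>I. \<Sum>b\<in>I. G a b * W a b)
      - S * H * (\<Sum>a\<in>I. \<Sum>b\<in>I. G a b * (U a * U b)) + S * (\<Sum>a\<in>I. \<Sum>b\<in>I. G a b * (U b * H1 a))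
      + S * (\<Sum>a\<in>I. \<Sum>b\<in>I. G a b * (U a * H1 b)) + S * S * H * (\<Sum>a\<in>I. \<Sum>b\<in>I. G a b * (U a * U b))"
    by (simp only: sum.distrib sum_subtractf sum_distrib_left)
  finally have *: "(\<Sum>a\<in>I. \<Sum>b\<in>I. G a b * (H2 a b + S * ((W a b - U a * U b) * H + U b * H1 a) +
      S * U a * (H1 b + S * U b * H))) =
    (\<Sum>a\<in>I. \<Sum>b\<in>I. G a b * H2 a b) + S * H * (\<Sum>a\<in>I. \<Sum>b\<in>I. G a b * W a b)
      - S * H * (\<Sum>b\<in>I. B b * U b) + S * (\<Sum>b\<in>I. B b * H1 b)
      + S * (\<Sum>b\<in>I. B b * H1 b) + S * S * H * (\<Sum>b\<in>I. B b * U b)"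
    unfolding UU UH HU .
  have **: "(\<Sum>b\<in>I. B b * (H1 b + S * U b * H)) =
      (\<Sum>b\<in>I. B b * H1 b) + S * H * (\<Sum>b\<in>I. B b * U b)"
  proof -
    have "(\<Sum>b\<in>I. B b * (H1 b + S * U b * H)) = (\<Sum>b\<in>I. B b * H1 b + S * H * (B b * U b))"
      by (intro sum.cong refl) (simp add: algebra_simps)
    then show ?thesis
      by (simp only: sum.distrib sum_distrib_left)
  qed
  have W': "(\<Sum>a\<in>I. \<Sum>b\<in>I. G a b * W a b) = h * (\<Sum>b\<in>I. B b * U b)"
  proof -
    have "h * (2 * x) = 2 * h * x" for x
      by (simp add: algebra_simps)
    then show ?thesis
      unfolding W[symmetric] half by simp
  qed
  \<comment> \<open>Here \<open>x\<close>, \<open>y\<close>, \<open>z\<close> are the sums of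
    \<open>G * H2\<close>, \<open>B * U\<close> and \<open>B * H1\<close>. The total coefficient of
    \<open>S * H * y\<close> is \<open>2 * h - 1\<close>, so the undifferentiated terms cancel for
    \<open>h = 1/2\<close>.\<close>
  have "x + S * H * (h * y) - S * H * y + S * z + S * z + S * S * H * y +
      (h - S) * (z + S * H * y) = x + (h + S) * z" for x y z
  proof -
    have "x + S * H * (h * y) - S * H * y + S * z + S * z + S * S * H * y +
        (h - S) * (z + S * H * y) = x + (h + S) * z + S * H * y * (2 * h - 1)"
      by (simp add: algebra_simps)
    then show ?thesis
      using half by simp
  qed
  then show ?thesis
    unfolding * ** W' .
qed

text \<open>The operator \<open>L(1/2 + s)\<close> with plain derivatives, acting on coefficients
  polynomial in \<open>s\<close>.\<close>

definition radial :: "nat \<Rightarrow> cmpoly poly \<Rightarrow> cmpoly poly" where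
  "radial k h = map_poly (second_part k) h + [:const_poly (1 / 2), 1:] * map_poly (first_part k) h"

text \<open>The operator \<open>L(1/2 - s)\<close> on multiples of \<open>f^s\<close>.\<close>

definition radial_fs :: "nat \<Rightarrow> cmpoly \<Rightarrow> cmpoly fract poly \<Rightarrow> cmpoly fract poly" where
  "radial_fs k f g =
     (\<Sum>a<k. \<Sum>b<k. smult (to_fract (gram k a b)) (deriv_fs f (Suc a) (deriv_fs f (Suc b) g))) +
     [:to_fract (const_poly (1 / 2)), - 1:] *
       (\<Sum>b<k. smult (to_fract (drift k b)) (deriv_fs f (Suc b) g))"

lemma second_part_0 [simp]: "second_part k 0 = 0"
  by (simp add: second_part_def)

lemma first_part_0 [simp]: "first_part k 0 = 0"
  by (simp add: first_part_def)

lemma map_poly_second_part: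
  "map_poly (second_part k) h = (\<Sum>a<k. \<Sum>b<k. smult (gram k a b)
     (map_poly (partial_deriv (Suc a)) (map_poly (partial_deriv (Suc b)) h)))"
  by (rule poly_eqI) (simp add: coeff_map_poly coeff_sum second_part_def)

lemma map_poly_first_part:
  "map_poly (first_part k) h =
     (\<Sum>b<k. smult (drift k b) (map_poly (partial_deriv (Suc b)) h))"
  by (rule poly_eqI) (simp add: coeff_map_poly coeff_sum first_part_def)

lemma map_poly_fract_deriv_fract_poly:
  "map_poly (fract_deriv i) (fract_poly h) = fract_poly (map_poly (partial_deriv i) h)"
  by (rule poly_eqI) (simp add: coeff_map_poly)

lemma deriv_fs_fract_poly:
  "deriv_fs f i (fract_poly h) = fract_poly (map_poly (partial_deriv i) h) +
     [:0, 1:] * [:to_fract (partial_deriv i f) / to_fract f:] * fract_poly h"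
  by (simp add: deriv_fs_def map_poly_fract_deriv_fract_poly)

lemma map_poly_fract_deriv_mult:
  "map_poly (fract_deriv i) ([:0, 1:] * [:u:] * fract_poly h) =
     [:0, 1:] * ([:fract_deriv i u:] * fract_poly h + [:u:] * fract_poly (map_poly (partial_deriv i) h))"
proof -
  have "map_poly (fract_deriv i) (smult u (fract_poly h)) =
      smult (fract_deriv i u) (fract_poly h) + smult u (fract_poly (map_poly (partial_deriv i) h))"
    by (rule poly_eqI) (simp add: coeff_map_poly fract_deriv_mult)
  then show ?thesis
    by (simp add: map_poly_pCons)
qed

text \<open>The quotient rule turns the derivative of \<open>U b\<close> into
  \<open>W a b - U a * U b\<close>; the terms are grouped as in
  \<open>sum_radial_identity\<close>.\<close>

lemma deriv_fs_deriv_fs_fract_poly: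
  assumes "f \<noteq> 0"
  defines "U \<equiv> \<lambda>a. [:to_fract (partial_deriv a f) / to_fract f:]"
    and "W \<equiv> \<lambda>a b. [:to_fract (partial_deriv a (partial_deriv b f)) / to_fract f:]"
    and "S \<equiv> [:0, 1:]"
    and "D \<equiv> \<lambda>a. map_poly (partial_deriv a)"
  shows "deriv_fs f a (deriv_fs f b (fract_poly h)) =
     fract_poly (D a (D b h)) +
     S * ((W a b - U a * U b) * fract_poly h + U b * fract_poly (D a h)) +
     S * U a * (fract_poly (D b h) + S * U b * fract_poly h)"
proof -
  let ?u = "\<lambda>a. to_fract (partial_deriv a f) / to_fract f"
  have u: "?u a = Fract (partial_deriv a f) f" for a
    by (simp add: Fract_conv_to_fract)
  have "fract_deriv a (?u b) = to_fract (partial_deriv a (partial_deriv b f)) / to_fract f - ?u a * ?u b"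
    unfolding u fract_deriv_Fract[OF assms(1)] using assms(1)
    by (simp add: Fract_conv_to_fract field_simps)
  then have V: "[:fract_deriv a (?u b):] = W a b - U a * U b"
    by (simp add: U_def W_def)
  have "deriv_fs f a (deriv_fs f b (fract_poly h)) =
      map_poly (fract_deriv a) (deriv_fs f b (fract_poly h)) + S * U a * deriv_fs f b (fract_poly h)"
    unfolding deriv_fs_def[of f a] by (simp add: S_def U_def)
  then show ?thesis
    unfolding deriv_fs_fract_poly[of f b]
      map_poly_additive[of "fract_deriv a", OF fract_deriv_0 fract_deriv_add]
      map_poly_fract_deriv_mult map_poly_fract_deriv_fract_poly V
    by (simp only: U_def S_def D_def add.assoc)
qed

text \<open>Conjugation by \<open>f^s\<close> turns \<open>L(1/2 - s)\<close> into
  \<open>L(1/2 + s)\<close>, and all denominators cancel. The result again lies in the image of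
  \<open>fract_poly\<close>, so the step can be iterated.\<close>

lemma radial_fs_fract_poly:
  assumes f: "variables f \<subseteq> {1..k}" "to_z k f = (vandermonde k)\<^sup>2"
  shows "radial_fs k f (fract_poly h) = fract_poly (radial k h)"
proof -
  let ?D = "\<lambda>a. map_poly (partial_deriv (Suc a))"
  define U where "U a = [:to_fract (partial_deriv (Suc a) f) / to_fract f:]" for a
  define W where "W a b = [:to_fract (partial_deriv (Suc a) (partial_deriv (Suc b) f)) / to_fract f:]" for a b
  define G where "G a b = [:to_fract (gram k a b):]" for a b
  define B where "B b = [:to_fract (drift k b):]" for b
  have f0: "f \<noteq> 0"
    using f by (rule discriminant_nonzero)
  have to_fract_sum: "to_fract (\<Sum>a\<in>I. g a) = (\<Sum>a\<in>I. to_fract (g a))" for g :: "nat \<Rightarrow> cmpoly" and I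
    by (induction I rule: infinite_finite_induct) simp_all
  have sum_pCons: "(\<Sum>a\<in>I. [:g a:]) = [:\<Sum>a\<in>I. g a:]" for g :: "nat \<Rightarrow> cmpoly fract" and I
    by (induction I rule: infinite_finite_induct) simp_all
  \<comment> \<open>This and the next fact are the two identities for the discriminant, divided by
    \<open>f\<close>.\<close>
  have 1: "(\<Sum>a<k. G a b * U a) = B b" for b
  proof -
    have "(\<Sum>a<k. to_fract (gram k a b) * (to_fract (partial_deriv (Suc a) f) / to_fract f)) =
        to_fract (\<Sum>a<k. gram k a b * partial_deriv (Suc a) f) / to_fract f"
      by (simp add: to_fract_sum sum_divide_distrib)
    then show ?thesis
      using f0 unfolding sum_gram_partial_deriv[OF f] by (simp add: G_def U_def B_def sum_pCons mult.commute)
  qed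
  have 2: "2 * (\<Sum>a<k. \<Sum>b<k. G a b * W a b) = (\<Sum>b<k. B b * U b)"
  proof -
    have "(\<Sum>a<k. \<Sum>b<k. to_fract (gram k a b) *
          (to_fract (partial_deriv (Suc a) (partial_deriv (Suc b) f)) / to_fract f)) =
        to_fract (second_part k f) / to_fract f"
      by (simp add: second_part_def to_fract_sum sum_divide_distrib)
    moreover have "(\<Sum>b<k. to_fract (drift k b) * (to_fract (partial_deriv (Suc b) f) / to_fract f)) =
        to_fract (first_part k f) / to_fract f"
      by (simp add: first_part_def to_fract_sum sum_divide_distrib)
    moreover have "to_fract (first_part k f) = to_fract (second_part k f) + to_fract (second_part k f)"
      unfolding second_part_discriminant[OF f, symmetric] by (simp flip: to_fract_add)
    ultimately show ?thesis
      unfolding mult_2 by (simp add: G_def W_def B_def U_def sum_pCons add_divide_distrib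
        mult.commute)
  qed
  have half: "const_poly (1 / 2) + const_poly (1 / 2) = 1"
    by (simp flip: const_poly_add)
  have 3: "2 * [:to_fract (const_poly (1 / 2)):] = 1"
    unfolding mult_2 using half by (simp flip: to_fract_add)
  have 4: "[:to_fract (const_poly (1 / 2)), - 1:] = [:to_fract (const_poly (1 / 2)):] - [:0, 1:]"
    "fract_poly [:const_poly (1 / 2), 1:] = [:to_fract (const_poly (1 / 2)):] + [:0, 1:]"
    by (simp_all add: map_poly_pCons)
  have sm: "smult c p = [:c:] * p" for c :: "cmpoly fract" and p
    by simp
  have "radial_fs k f (fract_poly h) =
      (\<Sum>a<k. \<Sum>b<k. G a b * (fract_poly (?D a (?D b h)) +
       [:0, 1:] * ((W a b - U a * U b) * fract_poly h + U b * fract_poly (?D a h)) +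
       [:0, 1:] * U a * (fract_poly (?D b h) + [:0, 1:] * U b * fract_poly h))) +
      ([:to_fract (const_poly (1 / 2)):] - [:0, 1:]) *
       (\<Sum>b<k. B b * (fract_poly (?D b h) + [:0, 1:] * U b * fract_poly h))"
    unfolding radial_fs_def deriv_fs_deriv_fs_fract_poly[OF f0]
    unfolding deriv_fs_fract_poly 4 sm G_def B_def U_def W_def ..
  also have "\<dots> = (\<Sum>a<k. \<Sum>b<k. G a b * fract_poly (?D a (?D b h))) +
      ([:to_fract (const_poly (1 / 2)):] + [:0, 1:]) * (\<Sum>b<k. B b * fract_poly (?D b h))"
    by (rule sum_radial_identity[OF 1 _ 2 3]) (simp add: G_def gram_commute)
  also have "\<dots> = fract_poly (radial k h)"
    unfolding radial_def map_poly_second_part map_poly_first_part fract_poly_add fract_poly_mult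
      fract_poly_sum fract_poly_smult 4 by (simp add: G_def B_def)
  finally show ?thesis .
qed

section \<open>The radial operator belongs to the Weyl algebra\<close>

lemma weyl_scale:
  assumes "variables p \<subseteq> {1..k}" "P \<in> weyl_algebra_s k f"
  shows "(\<lambda>g. smult (to_fract p) (P g)) \<in> weyl_algebra_s k f"
proof -
  have "(\<lambda>g. smult (to_fract p) g) \<in> weyl_algebra_s k f"
    using assms(1)
  proof (induction p rule: cmpoly_induct)
    case (add p q)
    then show ?case
      using weyl_algebra_s.add[of "smult (to_fract p)" k f "smult (to_fract q)"]
      by (simp add: smult_add_left)
  next
    case (mult p q)
    then show ?case
      using weyl_algebra_s.mult[of "smult (to_fract p)" k f "smult (to_fract q)"]
      by (simp add: comp_def)
  qed (auto intro: weyl_algebra_s.intros)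
  from weyl_algebra_s.mult[OF this assms(2)] show ?thesis
    by (simp add: comp_def)
qed

lemma weyl_zero: "(\<lambda>g. 0) \<in> weyl_algebra_s k f"
proof -
  have "(\<lambda>g. 0) = (\<lambda>g. smult (to_fract (const_poly 0)) g)"
    by (simp add: fun_eq_iff)
  then show ?thesis
    by (simp only: weyl_algebra_s.scalar)
qed

lemma weyl_id: "(\<lambda>g. g) \<in> weyl_algebra_s k f"
proof -
  have "(\<lambda>g. g) = (\<lambda>g. smult (to_fract (const_poly 1)) g)"
    by (simp add: fun_eq_iff)
  then show ?thesis
    by (simp only: weyl_algebra_s.scalar)
qed

lemma weyl_sum:
  "(\<And>a. a \<in> I \<Longrightarrow> P a \<in> weyl_algebra_s k f) \<Longrightarrow> (\<lambda>g. \<Sum>a\<in>I. P a g) \<in> weyl_algebra_s k f"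
  by (induction I rule: infinite_finite_induct) (auto intro: weyl_zero weyl_algebra_s.add)

abbreviation cpoly_fract :: "complex poly \<Rightarrow> cmpoly fract poly" where
  "cpoly_fract \<equiv> map_poly (\<lambda>c. to_fract (const_poly c))"

lemma cpoly_fract_pCons: "cpoly_fract (pCons c p) = pCons (to_fract (const_poly c)) (cpoly_fract p)"
  by (simp add: map_poly_pCons)

lemma weyl_poly_mult:
  assumes "P \<in> weyl_algebra_s k f"
  shows "(\<lambda>g. cpoly_fract q * P g) \<in> weyl_algebra_s k f"
proof -
  have "(\<lambda>g. cpoly_fract q * g) \<in> weyl_algebra_s k f"
  proof (induction q)
    case 0
    then show ?case by (simp add: weyl_zero)
  next
    case (pCons c q)
    have "(\<lambda>g. smult (to_fract (const_poly c)) g + ((\<lambda>g. [:0, 1:] * g) \<circ> (\<lambda>g. cpoly_fract q * g)) g)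
        \<in> weyl_algebra_s k f"
      by (intro weyl_algebra_s.add weyl_algebra_s.mult weyl_algebra_s.scalar weyl_algebra_s.s
          pCons.IH)
    then show ?case
      by (simp add: cpoly_fract_pCons)
  qed
  from weyl_algebra_s.mult[OF this assms] show ?thesis
    by (simp add: comp_def)
qed

lemma weyl_radial_fs: "radial_fs k f \<in> weyl_algebra_s k f"
proof -
  have "cpoly_fract [:1 / 2, - 1:] = [:to_fract (const_poly (1 / 2)), - 1:]"
    by (simp add: cpoly_fract_pCons const_poly_uminus)
  moreover have "(\<lambda>g. (\<Sum>a<k. \<Sum>b<k. smult (to_fract (gram k a b))
        ((deriv_fs f (Suc a) \<circ> deriv_fs f (Suc b)) g)) +
      cpoly_fract [:1 / 2, - 1:] * (\<Sum>b<k. smult (to_fract (drift k b)) (deriv_fs f (Suc b) g)))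
      \<in> weyl_algebra_s k f"
    by (intro weyl_algebra_s.add weyl_sum weyl_poly_mult weyl_scale variables_gram variables_drift
        weyl_algebra_s.mult weyl_algebra_s.partial) auto
  ultimately show ?thesis
    unfolding radial_fs_def[abs_def] by simp
qed

lemma weyl_funpow: "P \<in> weyl_algebra_s k f \<Longrightarrow> P ^^ n \<in> weyl_algebra_s k f"
  by (induction n) (auto intro: weyl_algebra_s.mult simp: weyl_id id_def)

lemma cpoly_fract_add: "cpoly_fract (p + q) = cpoly_fract p + cpoly_fract q"
  by (rule map_poly_additive) (simp_all add: const_poly_add)

lemma cpoly_fract_mult: "cpoly_fract (p * q) = cpoly_fract p * cpoly_fract q"
proof (induction p)
  case (pCons c p)
  have "cpoly_fract (smult c q) = smult (to_fract (const_poly c)) (cpoly_fract q)"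
    by (rule poly_eqI) (simp add: coeff_map_poly const_poly_mult)
  then show ?case
    using pCons by (simp add: cpoly_fract_add cpoly_fract_pCons)
qed simp

section \<open>The ideal of solutions of the Bernstein equation\<close>

lemma bernstein_equation_add:
  assumes "bernstein_equation k f b" "bernstein_equation k f c"
  shows "bernstein_equation k f (b + c)"
proof -
  obtain P Q where "P \<in> weyl_algebra_s k f" "P [:to_fract f:] = cpoly_fract b"
    and "Q \<in> weyl_algebra_s k f" "Q [:to_fract f:] = cpoly_fract c"
    using assms by (auto simp: bernstein_equation_def)
  then show ?thesis
    unfolding bernstein_equation_def
    by (intro bexI[of _ "\<lambda>g. P g + Q g"]) (auto simp: cpoly_fract_add intro: weyl_algebra_s.add)
qed

lemma bernstein_equation_mult:
  assumes "bernstein_equation k f b"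
  shows "bernstein_equation k f (q * b)"
proof -
  obtain Q where Q: "Q \<in> weyl_algebra_s k f" "Q [:to_fract f:] = cpoly_fract b"
    using assms by (auto simp: bernstein_equation_def)
  then show ?thesis
    unfolding bernstein_equation_def
    by (intro bexI[of _ "\<lambda>g. cpoly_fract q * Q g"])
      (auto simp: cpoly_fract_mult intro: weyl_poly_mult)
qed

text \<open>The solutions form an ideal of the polynomials in \<open>s\<close>. A nonzero remainder
  of \<open>c\<close> modulo \<open>b\<close>, made monic, would be a solution of smaller degree
  than \<open>b\<close>.\<close>

lemma bernstein_polynomial_dvd:
  assumes b: "is_bernstein_polynomial k f b" and c: "bernstein_equation k f c"
  shows "b dvd c"
proof -
  define r where "r = c mod b"
  have "b \<noteq> 0"
    using b by (auto simp: is_bernstein_polynomial_def)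
  have "bernstein_equation k f (c + [:- 1:] * (c div b) * b)"
    using b c by (intro bernstein_equation_add bernstein_equation_mult)
      (simp_all add: is_bernstein_polynomial_def)
  then have r: "bernstein_equation k f r"
    by (simp add: r_def minus_div_mult_eq_mod[symmetric])
  have "r = 0"
  proof (rule ccontr)
    assume "r \<noteq> 0"
    define r' where "r' = [:inverse (lead_coeff r):] * r"
    have "lead_coeff r' = 1" "Polynomial.degree r' = Polynomial.degree r"
      using \<open>r \<noteq> 0\<close> by (simp_all add: r'_def)
    moreover have "bernstein_equation k f r'"
      unfolding r'_def by (rule bernstein_equation_mult[OF r])
    ultimately have "Polynomial.degree b \<le> Polynomial.degree r"
      using b by (metis is_bernstein_polynomial_def)
    then show False
      using degree_mod_less[OF \<open>b \<noteq> 0\<close>, of c] \<open>r \<noteq> 0\<close> by (simp add: r_def)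
  qed
  then show ?thesis
    by (simp add: r_def dvd_eq_mod_eq_0)
qed

section \<open>The functional equation\<close>

text \<open>The operator is linear over the constants, hence commutes with evaluating
  \<open>s\<close> at a constant.\<close>

lemma map_poly_second_part_eval:
  "poly (map_poly (second_part k) h) (const_poly c) = second_part k (poly h (const_poly c))"
proof (induction h)
  case (pCons p h)
  have "second_part k (p + const_poly c * q) = second_part k p + const_poly c * second_part k q" for q
    unfolding second_part_def
    by (simp add: partial_deriv_add partial_deriv_mult sum.distrib sum_distrib_left algebra_simps)
  then show ?case
    using pCons by (simp add: map_poly_pCons)
qed simp

text \<open>At this point the factor \<open>1/2 + s\<close> of the first-order part vanishes, which
  leaves the Laplacian alone.\<close>

lemma poly_radial_minus_half:
  "poly (radial k h) (const_poly (- 1 / 2)) = second_part k (poly h (const_poly (- 1 / 2)))"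
proof -
  have "poly [:const_poly (1 / 2), 1:] (const_poly (- 1 / 2)) = 0"
    by (simp flip: const_poly_add)
  then show ?thesis
    unfolding radial_def poly_add poly_mult map_poly_second_part_eval by simp
qed

lemma radial_preserves:
  assumes "\<And>n. variables (coeff h n) \<subseteq> {1..k}" "\<And>n. homogeneous k d (coeff h n)"
  shows "variables (coeff (radial k h) n) \<subseteq> {1..k}" "homogeneous k (d - 2) (coeff (radial k h) n)"
proof -
  \<comment> \<open>The factor \<open>s\<close> shifts the coefficients of the first-order part by
    one, hence the case distinction.\<close>
  have coeff: "coeff (radial k h) n = second_part k (coeff h n) +
      const_poly (1 / 2) * first_part k (coeff h n) +
      (case n of 0 \<Rightarrow> 0 | Suc m \<Rightarrow> first_part k (coeff h m))"
    by (simp add: radial_def coeff_map_poly coeff_pCons split: nat.split)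
  show "variables (coeff (radial k h) n) \<subseteq> {1..k}"
    unfolding coeff using assms(1) variables_first_part[OF assms(1)]
    by (intro variables_add_subset variables_mult_subset variables_second_part variables_first_part)
      (simp_all split: nat.split)
  show "homogeneous k (d - 2) (coeff (radial k h) n)"
    unfolding coeff using assms(2)
    by (intro homogeneous_add homogeneous_scalar_mult homogeneous_const homogeneous_second_part
        homogeneous_first_part) (auto intro!: homogeneous_first_part split: nat.splits)
qed

lemma bernstein_equation_discriminant:
  assumes f: "variables f \<subseteq> {1..k}" "to_z k f = (vandermonde k)\<^sup>2"
  shows "\<exists>c. bernstein_equation k f c \<and> poly c (- 1 / 2) \<noteq> 0"
proof -
  \<comment> \<open>\<open>h n\<close> is the coefficient of \<open>f^s\<close> in the result of
    applying \<open>L(1/2 - s)\<close> to \<open>f^(s+1)\<close> \<open>n\<close> times.\<close>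
  define h where "h n = (radial k ^^ n) [:f:]" for n
  define N where "N = card (pairs k)"
  have h: "variables (coeff (h n) m) \<subseteq> {1..k} \<and>
      homogeneous k (2 * int N - 2 * int n) (coeff (h n) m)" for n m
  proof (induction n arbitrary: m)
    case 0
    then show ?case
      using f(1) homogeneous_discriminant[OF f] by (auto simp: h_def N_def coeff_pCons split: nat.split)
  next
    case (Suc n)
    then show ?case
      using radial_preserves[of "h n" k "2 * int N - 2 * int n" m] by (simp add: h_def algebra_simps)
  qed
  \<comment> \<open>The discriminant has degree \<open>2 N\<close> and each step lowers the degree
    by 2, so the coefficients of \<open>h N\<close> have degree 0 and coincide with their constant
    terms.\<close>
  define c where "c = map_poly (\<lambda>p. Poly_Mapping.lookup p 0) (h N)"
  have const: "const_poly (Poly_Mapping.lookup (coeff (h N) m) 0) = coeff (h N) m" for m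
  proof -
    obtain x where "coeff (h N) m = const_poly x"
      by (rule weighted_euler_eq_0_imp_const[of "\<lambda>a. a" "{1..k}" "coeff (h N) m"])
        (use h[of N m] in \<open>auto simp: homogeneous_def\<close>)
    then show ?thesis
      by (simp add: const_poly_def)
  qed
  have hc: "h N = map_poly const_poly c"
    by (rule poly_eqI) (simp add: c_def coeff_map_poly const)
  have "(radial_fs k f ^^ n) [:to_fract f:] = fract_poly (h n)" for n
    by (induction n) (simp_all add: h_def map_poly_pCons radial_fs_fract_poly[OF f])
  then have "(radial_fs k f ^^ N) [:to_fract f:] = cpoly_fract c"
    by (simp add: hc map_poly_map_poly comp_def)
  then have "bernstein_equation k f c"
    unfolding bernstein_equation_def using weyl_funpow[OF weyl_radial_fs] by blast
  moreover have "poly c (- 1 / 2) \<noteq> 0"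
  proof -
    have eval: "poly (map_poly const_poly q) (const_poly x) = const_poly (poly q x)" for q x
      by (induction q) (simp_all add: map_poly_pCons const_poly_add const_poly_mult)
    \<comment> \<open>At \<open>s = -1/2\<close> every iteration step is the Laplacian in
      \<open>z\<close>.\<close>
    have "variables (poly (h n) (const_poly (- 1 / 2))) \<subseteq> {1..k} \<and>
        to_z k (poly (h n) (const_poly (- 1 / 2))) =
          (laplacian {1..k} ^^ n) ((vandermonde k)\<^sup>2)" for n
    proof (induction n)
      case 0
      then show ?case using f by (simp add: h_def)
    next
      case (Suc n)
      have "poly (h (Suc n)) (const_poly (- 1 / 2)) =
          second_part k (poly (h n) (const_poly (- 1 / 2)))"
        by (simp only: h_def funpow.simps comp_apply poly_radial_minus_half)
      then show ?case
        using Suc by (simp only: variables_second_part to_z_second_part funpow.simps comp_apply)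
    qed
    \<comment> \<open>\<open>to_z\<close> leaves constants unchanged, so the value can be compared
      directly.\<close>
    from this[of N] have "const_poly (poly c (- 1 / 2)) =
        (laplacian {1..k} ^^ N) ((vandermonde k)\<^sup>2)"
      by (simp only: hc eval substitute_const_poly)
    then obtain r :: real where "r > 0" "const_poly (poly c (- 1 / 2)) = const_poly (of_real r)"
      using funpow_laplacian_vandermonde[of k] by (auto simp: N_def)
    then show ?thesis by simp
  qed
  ultimately show ?thesis by blast
qed

theorem corollary3p3p7:
  fixes k :: nat and \<Delta> :: cmpoly and b :: "complex poly"
  assumes "k \<ge> 1"
    and "is_discriminant k \<Delta>"
    and "is_bernstein_polynomial k \<Delta> b"
  shows "poly b (- 1 / 2) \<noteq> 0"
proof -
  have "variables \<Delta> \<subseteq> {1..k}" "to_z k \<Delta> = (vandermonde k)\<^sup>2"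
    using assms(2)
    by (simp_all add: is_discriminant_def vandermonde_def pairs_def prod_power_distrib
        case_prod_unfold)
  then obtain c where c: "bernstein_equation k \<Delta> c" "poly c (- 1 / 2) \<noteq> 0"
    using bernstein_equation_discriminant by blast
  \<comment> \<open>A zero of \<open>b\<close> at \<open>-1/2\<close> would be inherited by
    \<open>c\<close>.\<close>
  have "b dvd c"
    using assms(3) c(1) by (rule bernstein_polynomial_dvd)
  then show ?thesis
    using c(2) by (auto elim!: dvdE)
qed

end
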